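(* There exists a constant $C>0$ such that for every integer $n\ge 2$ the mixing time $t_{\mathrm{mix}}^{(n)}$ of the lazy upper triangular walk on $G_n(2)$ satisfies $t_{\mathrm{mix}}^{(n)} \leq C n^2$.
   Context: For $n\ge 2$, $G_n(2)$ is the group (under multiplication) of $n\times n$ upper triangular matrices with entries in the field $\mathbb{Z}_2$ and $1$'s along the diagonal. The upper triangular walk on $G_n(2)$ is the discrete-time Markov chain where each step chooses $i\in\{1,\dots,n-1\}$ uniformly at random and adds row $i+1$ to row $i$. The lazy upper triangular walk is the version in which each step chooses independently a uniformly random $i\in\{1,\dots,n-1\}$ and a uniformly random $a\in\mathbb{Z}_2$, and adds $a$ times row $i+1$ to row $i$ (so that with probability $1/2$ the chain does not move). Its stationary distribution is the uniform distribution on $G_n(2)$. The total variation distance between probability measures $\nu_1,\nu_2$ on a countable set $\Omega$ is $\|\nu_1-\nu_2\|_{TV}=\max_{A\subset\Omega}|\nu_1(A)-\nu_2(A)|=\frac12\sum_{x\in\Omega}|\nu_1(x)-\nu_2(x)|$. For an ergodic Markov chain $Y_t$ with state space $\Omega$ and stationary distribution $\nu$, the mixing time is $t_{\mathrm{mix}}=\inf\{t:\max_{y\in\Omega}\|\mathbb{P}_y(Y_t\in\cdot)-\nu\|_{TV}<\frac{1}{2e}\}$, where $\mathbb{P}_y$ is the law of the chain started at $y$ (and $t$ ranges over nonnegative integers in discrete time). $t_{\mathrm{mix}}^{(n)}$ denotes the mixing time of the lazy upper triangular walk on $G_n(2)$. *)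

theory Defs
  imports
    "HOL-Probability.Probability"
    "HOL-Library.Z2"
    "Jordan_Normal_Form.Determinant"
begin

section \<open>Total variation distance and mixing times\<close>

definition tv_dist :: "'s set \<Rightarrow> 's pmf \<Rightarrow> 's pmf \<Rightarrow> real" where
  "tv_dist \<Omega> p q = (SUP A\<in>Pow \<Omega>. \<bar>measure_pmf.prob p A - measure_pmf.prob q A\<bar>)"

primrec chain_law :: "('s \<Rightarrow> 's pmf) \<Rightarrow> 's \<Rightarrow> nat \<Rightarrow> 's pmf" where
  "chain_law K y 0 = return_pmf y"
| "chain_law K y (Suc t) = bind_pmf (chain_law K y t) K"

text \<open>
  The value is an extended natural number: the infimum of the empty set is
  \<^term>\<open>\<infinity> :: enat\<close>, whereas on \<^typ>\<open>nat\<close> it would be \<^term>\<open>0 :: nat\<close>.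
\<close>

definition mixing_time :: "'s set \<Rightarrow> ('s \<Rightarrow> 's pmf) \<Rightarrow> 's pmf \<Rightarrow> enat" where
  "mixing_time \<Omega> K \<nu> =
     (INF t\<in>{t::nat. (SUP y\<in>\<Omega>. tv_dist \<Omega> (chain_law K y t) \<nu>) < 1 / (2 * exp 1)}. enat t)"

section \<open>The lazy upper triangular walk\<close>

definition unitri_group :: "nat \<Rightarrow> bit mat monoid" where
  "unitri_group n =
     \<lparr>carrier = {M \<in> carrier_mat n n. upper_triangular M \<and> (\<forall>i<n. M $$ (i, i) = 1)},
      mult = (*), one = 1\<^sub>m n\<rparr>"

text \<open>
  Matrix indices start at 0, so the rows numbered \<open>i\<close> and \<open>i + 1\<close> when counting from 1 are
  the rows \<open>i - 1\<close> and \<open>i\<close> here; \<open>addrow a k l M\<close> adds \<open>a\<close> times row \<open>l\<close> to row \<open>k\<close>.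
\<close>

definition lazy_step :: "nat \<Rightarrow> bit mat \<Rightarrow> bit mat pmf" where
  "lazy_step n M =
     do {
       i \<leftarrow> pmf_of_set {1..n - 1};
       a \<leftarrow> pmf_of_set (UNIV :: bit set);
       return_pmf (addrow a (i - 1) i M)
     }"

definition t_mix :: "nat \<Rightarrow> enat" where
  "t_mix n =
     mixing_time (carrier (unitri_group n)) (lazy_step n) (pmf_of_set (carrier (unitri_group n)))"

section \<open>Basic facts\<close>

lemma UNIV_bit: "(UNIV :: bit set) = {0, 1}"
  using bit_not_zero_iff by blast

lemma finite_bit [simp]: "finite (UNIV :: bit set)"
  by (simp add: UNIV_bit)

lemma carrier_unitri:
  "M \<in> carrier (unitri_group n) \<longleftrightarrow>
     M \<in> carrier_mat n n \<and> (\<forall>i<n. \<forall>j<i. M $$ (i, j) = 0) \<and> (\<forall>i<n. M $$ (i, i) = 1)"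
  by (auto simp: unitri_group_def upper_triangular_def)

lemma finite_unitri: "finite (carrier (unitri_group n))"
proof -
  let ?I = "{..<n} \<times> {..<n}"
  have "carrier (unitri_group n) \<subseteq> mat n n ` (?I \<rightarrow>\<^sub>E (UNIV :: bit set))"
  proof
    fix M assume "M \<in> carrier (unitri_group n)"
    then have "M \<in> carrier_mat n n" by (simp add: carrier_unitri)
    then have "M = mat n n (restrict (($$) M) ?I)" by (intro eq_matI) auto
    then show "M \<in> mat n n ` (?I \<rightarrow>\<^sub>E (UNIV :: bit set))"
      by (metis (no_types, lifting) UNIV_I image_eqI restrict_PiE_iff)
  qed
  moreover have "finite (mat n n ` (?I \<rightarrow>\<^sub>E (UNIV :: bit set)))"
    by (intro finite_imageI finite_PiE) auto
  ultimately show ?thesis by (rule finite_subset)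
qed

lemma one_unitri: "1\<^sub>m n \<in> carrier (unitri_group n)"
  by (auto simp: carrier_unitri)

lemma mult_unitri:
  assumes A: "A \<in> carrier (unitri_group n)" and B: "B \<in> carrier (unitri_group n)"
  shows "A * B \<in> carrier (unitri_group n)"
proof -
  have d: "A \<in> carrier_mat n n" "B \<in> carrier_mat n n"
    using A B by (auto simp: carrier_unitri)
  have e: "(A * B) $$ (i, j) = (\<Sum>k\<in>{0..<n}. A $$ (i, k) * B $$ (k, j))"
    if "i < n" "j < n" for i j
    using d that by (auto simp: scalar_prod_def intro!: sum.cong)
  have "(A * B) $$ (i, j) = 0" if "i < n" "j < i" for i j
  proof -
    have "A $$ (i, k) * B $$ (k, j) = 0" if "k < n" for k
      using A B that \<open>i < n\<close> \<open>j < i\<close> by (cases "k < i") (auto simp: carrier_unitri)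
    then have "(\<Sum>k\<in>{0..<n}. A $$ (i, k) * B $$ (k, j)) = 0"
      by (intro sum.neutral ballI) simp
    then show ?thesis using e[of i j] that by (metis less_trans)
  qed
  moreover have "(A * B) $$ (i, i) = 1" if "i < n" for i
  proof -
    have "A $$ (i, k) * B $$ (k, i) = (if k = i then 1 else 0)" if "k < n" for k
      using A B that \<open>i < n\<close> by (cases k i rule: linorder_cases) (auto simp: carrier_unitri)
    then have "(A * B) $$ (i, i) = (\<Sum>k\<in>{0..<n}. if k = i then 1 else 0)"
      using that by (subst e) (auto intro!: sum.cong)
    then show ?thesis using that by simp
  qed
  ultimately show ?thesis using d by (auto simp: carrier_unitri)
qed

lemma group_unitri: "group (unitri_group n)"
proof (rule groupI)
  let ?G = "carrier (unitri_group n)"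
  have ops: "A \<otimes>\<^bsub>unitri_group n\<^esub> B = A * B" "\<one>\<^bsub>unitri_group n\<^esub> = 1\<^sub>m n" for A B
    by (simp_all add: unitri_group_def)
  have dim: "A \<in> carrier_mat n n" if "A \<in> ?G" for A
    using that by (simp add: carrier_unitri)
  show "\<one>\<^bsub>unitri_group n\<^esub> \<in> ?G" by (simp add: ops one_unitri)
  fix A assume A: "A \<in> ?G"
  show "\<one>\<^bsub>unitri_group n\<^esub> \<otimes>\<^bsub>unitri_group n\<^esub> A = A"
    using dim[OF A] by (simp add: ops)
  show "\<exists>B\<in>?G. B \<otimes>\<^bsub>unitri_group n\<^esub> A = \<one>\<^bsub>unitri_group n\<^esub>"
  proof -
    have "upper_triangular A" using A by (simp add: unitri_group_def)
    then have "det A = (\<Prod>i = 0..<n. A $$ (i, i))"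
      using dim[OF A] by (simp add: det_upper_triangular prod_list_diag_prod)
    also have "\<dots> = 1" using A by (intro prod.neutral) (auto simp: carrier_unitri)
    finally have "A \<in> Units (ring_mat TYPE(bit) n ())"
      by (intro det_non_zero_imp_unit dim[OF A]) simp
    then obtain C where C: "C \<in> carrier_mat n n" "A * C = 1\<^sub>m n"
      by (auto simp: Units_def ring_mat_simps)
    have "inj_on (\<lambda>B. B * A) ?G"
    proof (rule inj_onI)
      fix B B' assume B: "B \<in> ?G" "B' \<in> ?G" and eq: "B * A = B' * A"
      have "X = (X * A) * C" if "X \<in> ?G" for X
        using dim[OF that] dim[OF A] C by (simp add: assoc_mult_mat[of X n n A n C n])
      then show "B = B'" using B eq by metis
    qed
    then have "(\<lambda>B. B * A) ` ?G = ?G"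
      using A by (intro endo_inj_surj finite_unitri) (auto intro: mult_unitri)
    then have "1\<^sub>m n \<in> (\<lambda>B. B * A) ` ?G" using one_unitri[of n] by simp
    then show ?thesis unfolding ops by (metis imageE)
  qed
  fix B assume B: "B \<in> ?G"
  show "A \<otimes>\<^bsub>unitri_group n\<^esub> B \<in> ?G" using A B by (simp add: ops mult_unitri)
  fix C assume C: "C \<in> ?G"
  show "A \<otimes>\<^bsub>unitri_group n\<^esub> B \<otimes>\<^bsub>unitri_group n\<^esub> C = A \<otimes>\<^bsub>unitri_group n\<^esub> (B \<otimes>\<^bsub>unitri_group n\<^esub> C)"
    using dim[OF A] dim[OF B] dim[OF C] by (simp add: ops assoc_mult_mat[of A n n B n C n])
qed

lemma addrow_unitri:
  assumes "M \<in> carrier (unitri_group n)" "i \<in> {1..n - 1}"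
  shows "addrow a (i - 1) i M \<in> carrier (unitri_group n)"
  using assms by (auto simp: carrier_unitri)

lemma addrow_addrow_bit:
  fixes M :: "bit mat"
  assumes "M \<in> carrier_mat n n" "i \<in> {1..n - 1}"
  shows "addrow a (i - 1) i (addrow a (i - 1) i M) = M"
  using assms by (intro eq_matI) (auto simp flip: add.assoc)

lemma bij_betw_addrow:
  assumes "i \<in> {1..n - 1}"
  shows "bij_betw (addrow a (i - 1) i) (carrier (unitri_group n)) (carrier (unitri_group n))"
  using assms addrow_unitri addrow_addrow_bit
  by (intro bij_betw_byWitness[where f' = "addrow a (i - 1) i"]) (auto simp: carrier_unitri)

lemma lazy_step_closed:
  assumes "n \<ge> 2" "M \<in> carrier (unitri_group n)"
  shows "set_pmf (lazy_step n M) \<subseteq> carrier (unitri_group n)"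
proof -
  have "{1..n - 1} \<noteq> {}" using assms by simp
  then show ?thesis using assms addrow_unitri by (auto simp: lazy_step_def)
qed

lemma uniform_stationary:
  assumes "n \<ge> 2"
  shows "bind_pmf (pmf_of_set (carrier (unitri_group n))) (lazy_step n) =
         pmf_of_set (carrier (unitri_group n))"
proof -
  let ?U = "pmf_of_set (carrier (unitri_group n))"
  have ne: "{1..n - 1} \<noteq> {}" using assms by simp
  have "bind_pmf ?U (lazy_step n) =
      bind_pmf (pmf_of_set {1..n - 1}) (\<lambda>i. bind_pmf (pmf_of_set UNIV)
        (\<lambda>a. map_pmf (addrow a (i - 1) i) ?U))"
    unfolding lazy_step_def map_pmf_def
    by (subst bind_commute_pmf, subst (2) bind_commute_pmf) (rule refl)
  also have "\<dots> = bind_pmf (pmf_of_set {1..n - 1}) (\<lambda>i. bind_pmf (pmf_of_set (UNIV :: bit set)) (\<lambda>a. ?U))"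
  proof (intro bind_pmf_cong refl)
    fix i and a :: bit
    assume "i \<in> set_pmf (pmf_of_set {1..n - 1})"
    then have "i \<in> {1..n - 1}" using ne by simp
    then show "map_pmf (addrow a (i - 1) i) ?U = ?U"
      using one_unitri[of n]
      by (intro map_pmf_of_set_bij_betw bij_betw_addrow finite_unitri) auto
  qed
  finally show ?thesis by simp
qed

end

theory Submission
  imports Defs
begin

text \<open>
  For a nonzero column vector \<open>v\<close>, the vector \<open>M v\<close> moves like the East model: bit \<open>k\<close> is resampled
  when bit \<open>k + 1\<close> is 1. Given the evolution of the rows below row \<open>r\<close>, row \<open>r\<close> has gained a random
  combination of the successive values of row \<open>r + 1\<close>, so in the direction of the character \<open>v\<close> it fails
  to be uniform only if bit \<open>r + 1\<close> of \<open>M v\<close> vanishes at every update of row \<open>r\<close>. Since the East model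
  has a spectral gap bounded below, uniformly in its length, this has probability at most
  \<open>2^(n/2) exp (- c t / n)\<close>, and for \<open>t\<close> a large multiple of \<open>n\<^sup>2\<close> this survives the union bound over
  the at most \<open>n 2^n\<close> pairs of a row and a character. The gap is bounded by bisection, following
  Cancrini, Martinelli, Roberto and Toninelli.
\<close>

section \<open>Averages over finitely many sites\<close>

text \<open>Information only moves up the matrix: the rows from \<open>r\<close> on evolve on their
  own. This forces the order of the Fourier decomposition: rows \<open>0\<close>, ...,
  \<open>r - 1\<close> are averaged out before a nontrivial character of row \<open>r\<close> is
  split off, so that each component ignores the rows above \<open>r\<close>. Laziness turns the
  addition of a bit 1 into an exact resampling of the bit it is added to. The obstacle is the
  uniformity of the gap. Plain halving loses a constant factor per doubling, hence only a power of
  the length. Letting the two intervals overlap in a long window makes the loss summable over the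
  scales. The gap controls a mean square, whereas the walk starts at a fixed matrix; the passage
  costs the number of configurations, which is the \<open>2^(n/2)\<close> after a square
  root.\<close>

type_synonym config = "nat \<Rightarrow> bool"

definition av :: "nat \<Rightarrow> (config \<Rightarrow> real) \<Rightarrow> config \<Rightarrow> real" where
  "av k f x = (f (x(k := False)) + f (x(k := True))) / 2"

text \<open>Expectation over fair bits in \<open>S\<close> with all other sites frozen at
  \<open>x\<close>. \<open>Finite_Set.fold\<close> returns \<open>f\<close> itself for infinite
  \<open>S\<close>, hence the finiteness hypotheses below.\<close>

definition Av :: "nat set \<Rightarrow> (config \<Rightarrow> real) \<Rightarrow> config \<Rightarrow> real" where
  "Av S f = Finite_Set.fold av f S"

lemma av_commute: "av j (av k f) = av k (av j f)"
  by (cases "j = k") (auto simp: av_def fun_eq_iff fun_upd_twist add_divide_distrib)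

interpretation av: comp_fun_commute av
  by unfold_locales (auto simp: fun_eq_iff av_commute)

lemma av_idem: "av k (av k f) = av k f"
  by (auto simp: av_def fun_eq_iff)

lemma Av_empty [simp]: "Av {} f = f"
  by (simp add: Av_def)

lemma Av_insert: "finite S \<Longrightarrow> k \<notin> S \<Longrightarrow> Av (insert k S) f = av k (Av S f)"
  by (simp add: Av_def)

lemma Av_insert2: "finite S \<Longrightarrow> k \<notin> S \<Longrightarrow> Av (insert k S) f = Av S (av k f)"
  by (simp add: Av_def av.fold_insert2 del: av.fold_insert)

lemma Av_singleton [simp]: "Av {k} f = av k f"
  by (simp add: Av_insert)

lemma Av_av_in: "finite S \<Longrightarrow> k \<in> S \<Longrightarrow> Av S (av k f) = Av S f"
  by (metis Av_insert2 av_idem finite_Diff insert_Diff Diff_iff singletonI)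

lemma av_Av_in: "finite S \<Longrightarrow> k \<in> S \<Longrightarrow> av k (Av S f) = Av S f"
  by (metis Av_insert av_idem finite_Diff insert_Diff Diff_iff singletonI)

lemma Av_Un: "finite S \<Longrightarrow> finite T \<Longrightarrow> Av (S \<union> T) f = Av S (Av T f)"
proof (induction S rule: finite_induct)
  case (insert k S)
  show ?case
  proof (cases "k \<in> T")
    case True
    then have "insert k S \<union> T = S \<union> T" by auto
    then show ?thesis using insert True by (simp add: Av_insert2 av_Av_in)
  next
    case False
    then show ?thesis using insert by (simp add: Av_insert)
  qed
qed simp

lemma Av_Av_subset:
  assumes "finite S" "T \<subseteq> S"
  shows "Av S (Av T f) = Av S f" and "Av T (Av S f) = Av S f"
  using assms Av_Un[of S T f] Av_Un[of T S f] finite_subset[of T S]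
  by (auto simp: Un_absorb1 Un_absorb2)

lemma Av_commute: "finite S \<Longrightarrow> finite T \<Longrightarrow> Av S (Av T f) = Av T (Av S f)"
  by (metis Av_Un Un_commute)

lemma Av_add: "finite S \<Longrightarrow> Av S (\<lambda>x. f x + g x) x = Av S f x + Av S g x"
  by (induction S arbitrary: x rule: finite_induct) (auto simp: Av_insert av_def field_simps)

lemma Av_cmult: "finite S \<Longrightarrow> Av S (\<lambda>x. c * f x) x = c * Av S f x"
  by (induction S arbitrary: x rule: finite_induct) (auto simp: Av_insert av_def field_simps)

lemma Av_diff: "finite S \<Longrightarrow> Av S (\<lambda>x. f x - g x) x = Av S f x - Av S g x"
  using Av_add[of S f "\<lambda>x. - 1 * g x" x] Av_cmult[of S "- 1" g x] by simp

lemma Av_const [simp]: "finite S \<Longrightarrow> Av S (\<lambda>x. c) x = c"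
  by (induction S arbitrary: x rule: finite_induct) (auto simp: Av_insert av_def field_simps)

lemma Av_sum:
  assumes "finite S" "finite I"
  shows "Av S (\<lambda>x. \<Sum>i\<in>I. f i x) x = (\<Sum>i\<in>I. Av S (f i) x)"
  using assms(2) by (induction I rule: finite_induct) (simp_all add: assms(1) Av_add)

text \<open>The comparison is asked only at configurations that agree with \<open>x\<close> off
  \<open>S\<close>; this is how boundary conditions such as \<open>x b\<close> enter the
  estimates.\<close>

lemma Av_mono:
  assumes "finite S" "\<And>y. (\<And>k. k \<notin> S \<Longrightarrow> y k = x k) \<Longrightarrow> f y \<le> g y"
  shows "Av S f x \<le> Av S g x"
  using assms
proof (induction S arbitrary: x rule: finite_induct)
  case (insert k S)
  have "Av S f (x(k := b)) \<le> Av S g (x(k := b))" for b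
    by (rule insert.IH, rule insert.prems) (use insert.hyps in auto)
  then show ?case using insert.hyps by (simp add: Av_insert av_def add_mono divide_right_mono)
qed auto

lemma Av_cong:
  assumes "finite S" "\<And>y. (\<And>k. k \<notin> S \<Longrightarrow> y k = x k) \<Longrightarrow> f y = g y"
  shows "Av S f x = Av S g x"
  by (intro antisym Av_mono) (use assms in auto)

lemma Av_nonneg: "finite S \<Longrightarrow> (\<And>y. 0 \<le> f y) \<Longrightarrow> 0 \<le> Av S f x"
  using Av_mono[of S x "\<lambda>_. 0" f] by simp

definition indep :: "nat set \<Rightarrow> (config \<Rightarrow> 'b) \<Rightarrow> bool" where
  "indep S f \<longleftrightarrow> (\<forall>k\<in>S. \<forall>x b. f (x(k := b)) = f x)"

lemma indep_subset: "indep S f \<Longrightarrow> T \<subseteq> S \<Longrightarrow> indep T f"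
  by (auto simp: indep_def)

lemma av_indep: "indep {k} f \<Longrightarrow> av k f = f"
  by (auto simp: indep_def av_def)

lemma Av_mult_indep:
  assumes "finite S" "indep S g"
  shows "Av S (\<lambda>x. g x * f x) = (\<lambda>x. g x * Av S f x)"
  using assms
proof (induction S rule: finite_induct)
  case (insert k S)
  then have "Av S (\<lambda>x. g x * f x) = (\<lambda>x. g x * Av S f x)" by (simp add: indep_def)
  then show ?case using insert by (auto simp: Av_insert indep_def av_def fun_eq_iff distrib_left)
qed simp

lemma Av_indep: "finite S \<Longrightarrow> indep S g \<Longrightarrow> Av S g = g"
  using Av_mult_indep[of S g "\<lambda>_. 1"] by (simp add: fun_eq_iff)

lemma indep_Av: "finite S \<Longrightarrow> indep S (Av S f)"
proof -
  have "Av S f (x(k := b)) = Av S f x" if "finite S" "k \<in> S" for k x b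
  proof -
    have "av k (Av S f) (x(k := b)) = av k (Av S f) x" by (simp add: av_def)
    then show ?thesis using that by (simp add: av_Av_in)
  qed
  then show "finite S \<Longrightarrow> indep S (Av S f)" by (auto simp: indep_def)
qed

text \<open>Each configuration on \<open>S\<close> has mass \<open>1 / 2 ^ card S\<close>, and the
  other ones contribute nonnegatively.\<close>

lemma Av_lower: "finite S \<Longrightarrow> (\<And>y. 0 \<le> f y) \<Longrightarrow> f x \<le> 2 ^ card S * Av S f x"
proof (induction S rule: finite_induct)
  case (insert k S)
  have eq: "2 * av k (Av S f) x = Av S f (x(k := \<not> x k)) + Av S f x"
  proof (cases "x k")
    case True then have "x(k := True) = x" by (auto simp: fun_eq_iff)
    then show ?thesis using True by (simp add: av_def)
  next
    case False then have "x(k := False) = x" by (auto simp: fun_eq_iff)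
    then show ?thesis using False by (simp add: av_def)
  qed
  have "0 \<le> Av S f (x(k := \<not> x k))" using insert by (intro Av_nonneg) auto
  then have "Av S f x \<le> 2 * av k (Av S f) x" using eq by linarith
  then have "2 ^ card S * Av S f x \<le> 2 ^ card S * (2 * av k (Av S f) x)"
    by (rule mult_left_mono) simp
  moreover have "f x \<le> 2 ^ card S * Av S f x" using insert by simp
  moreover have "2 ^ card S * (2 * av k (Av S f) x) = 2 ^ card (insert k S) * Av (insert k S) f x"
    using insert by (simp add: Av_insert)
  ultimately show ?case by linarith
qed simp

lemma Av_cauchy_schwarz:
  assumes "finite S"
  shows "(Av S (\<lambda>x. f x * g x) x)\<^sup>2 \<le> Av S (\<lambda>x. (f x)\<^sup>2) x * Av S (\<lambda>x. (g x)\<^sup>2) x"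
proof -
  let ?F = "Av S (\<lambda>x. (f x)\<^sup>2) x" and ?G = "Av S (\<lambda>x. (g x)\<^sup>2) x" and ?P = "Av S (\<lambda>x. f x * g x) x"
  have q: "0 \<le> a\<^sup>2 * ?F + 2 * (a * b * ?P) + b\<^sup>2 * ?G" for a b
  proof -
    have "0 \<le> Av S (\<lambda>x. (a * f x + b * g x)\<^sup>2) x" using assms by (intro Av_nonneg) auto
    also have "(\<lambda>x. (a * f x + b * g x)\<^sup>2) =
        (\<lambda>x. (a\<^sup>2 * (f x)\<^sup>2 + (2 * (a * b)) * (f x * g x)) + b\<^sup>2 * (g x)\<^sup>2)"
      by (auto simp: power2_eq_square algebra_simps)
    also have "Av S \<dots> x = a\<^sup>2 * ?F + 2 * (a * b) * ?P + b\<^sup>2 * ?G"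
      using assms by (simp only: Av_add Av_cmult)
    finally show ?thesis by (simp add: mult.assoc)
  qed
  have G: "0 \<le> ?G" using assms by (intro Av_nonneg) auto
  show ?thesis
  proof (cases "?G = 0")
    case True
    have "?P = 0"
    proof (rule ccontr)
      assume "?P \<noteq> 0"
      \<comment> \<open>These arguments give the quadratic form the value -1.\<close>
      then show False using q[of 1 "- (?F + 1) / (2 * ?P)"] True by (simp add: field_simps)
    qed
    then show ?thesis using True by simp
  next
    case False
    have "0 \<le> ?G * (?G * ?F - ?P\<^sup>2)" using q[of ?G "- ?P"]
      by (simp add: power2_eq_square algebra_simps)
    then show ?thesis using False G by (simp add: zero_le_mult_iff mult.commute)
  qed
qed

lemma Av_jensen: "finite S \<Longrightarrow> (Av S f x)\<^sup>2 \<le> Av S (\<lambda>x. (f x)\<^sup>2) x"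
  using Av_cauchy_schwarz[of S f "\<lambda>_. 1" x] by simp

section \<open>Conditional variances over finite sets of sites\<close>

definition Var :: "nat set \<Rightarrow> (config \<Rightarrow> real) \<Rightarrow> config \<Rightarrow> real" where
  "Var S f x = Av S (\<lambda>x. (f x)\<^sup>2) x - (Av S f x)\<^sup>2"

lemma Var_nonneg: "finite S \<Longrightarrow> 0 \<le> Var S f x"
  using Av_jensen[of S f x] by (simp add: Var_def)

lemma Av_Var:
  assumes "finite S"
  shows "Av S (\<lambda>y. (f y - Av S f y)\<^sup>2) x = Var S f x"
proof -
  have i: "indep S (Av S f)" "indep S (\<lambda>y. (Av S f y)\<^sup>2)"
    using indep_Av[OF assms, of f] by (auto simp: indep_def)
  have "(\<lambda>y. (f y - Av S f y)\<^sup>2) = (\<lambda>y. ((f y)\<^sup>2 - 2 * (Av S f y * f y)) + (Av S f y)\<^sup>2)"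
    by (auto simp: power2_eq_square algebra_simps)
  then have "Av S (\<lambda>y. (f y - Av S f y)\<^sup>2) x = Av S (\<lambda>x. (f x)\<^sup>2) x - 2 * (Av S f x * Av S f x) + (Av S f x)\<^sup>2"
    using assms i by (simp add: Av_add Av_diff Av_cmult Av_mult_indep Av_indep)
  then show ?thesis by (simp add: Var_def power2_eq_square)
qed

text \<open>Law of total variance: the difference is the variance of \<open>Av S f\<close> over
  \<open>T\<close>, nonnegative by Jensen.\<close>

lemma Av_Var_subset:
  assumes "finite T" "S \<subseteq> T"
  shows "Av T (Var S f) x \<le> Var T f x"
proof -
  have S: "finite S" using assms finite_subset by auto
  have "Av T (Var S f) x = Av T (Av S (\<lambda>x. (f x)\<^sup>2)) x - Av T (\<lambda>y. (Av S f y)\<^sup>2) x"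
    using assms unfolding Var_def by (simp add: Av_diff)
  also have "\<dots> \<le> Av T (\<lambda>x. (f x)\<^sup>2) x - (Av T (Av S f) x)\<^sup>2"
    using assms Av_jensen[of T "Av S f" x] by (simp add: Av_Av_subset)
  finally show ?thesis using assms by (simp add: Var_def Av_Av_subset)
qed

section \<open>Spectral gap of the East model\<close>

lemma two_block_real:
  fixes d X Y Z p :: real
  assumes "0 < d" "d < 1" "0 \<le> X" "0 \<le> Y" "0 \<le> Z"
    and "p\<^sup>2 \<le> (1 - d\<^sup>2) * Z * Y" "p\<^sup>2 \<le> d\<^sup>2 * Z * X"
  shows "0 \<le> d * X + (1 + d) * Y + d * (1 - d) * Z + 2 * p"
proof -
  let ?s = "d * X + (1 + d) * Y" and ?t = "d * (1 - d) * Z"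
  \<comment> \<open>The weights \<open>1 - d\<close> and \<open>d\<close> make the two bounds
    combine into the product \<open>?s * ?t\<close>.\<close>
  have "(2 * p)\<^sup>2 = 4 * ((1 - d) * p\<^sup>2 + d * p\<^sup>2)" by (simp add: power2_eq_square algebra_simps)
  also have "\<dots> \<le> 4 * ((1 - d) * (d\<^sup>2 * Z * X) + d * ((1 - d\<^sup>2) * Z * Y))"
    using assms by (intro mult_left_mono add_mono) auto
  also have "\<dots> = 4 * ?s * ?t" by (simp add: power2_eq_square algebra_simps)
  also have "\<dots> \<le> (?s + ?t)\<^sup>2"
    using zero_le_power2[of "?s - ?t"] by (simp add: power2_eq_square algebra_simps)
  finally have "\<bar>2 * p\<bar> \<le> \<bar>?s + ?t\<bar>" by (simp add: abs_le_square_iff)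
  moreover have "0 \<le> ?s + ?t" using assms by (intro add_nonneg_nonneg mult_nonneg_nonneg) auto
  ultimately show ?thesis by linarith
qed

lemma Av_none:
  assumes "finite S"
  shows "Av S (\<lambda>y. of_bool (\<forall>k\<in>S. \<not> y k)) x = 1 / 2 ^ card S"
  using assms
proof (induction S arbitrary: x rule: finite_induct)
  case (insert k S)
  have "(\<lambda>y. of_bool (\<forall>j\<in>insert k S. \<not> y j)) = (\<lambda>y. of_bool (\<not> y k) * of_bool (\<forall>j\<in>S. \<not> y j) :: real)"
    by auto
  moreover have "indep S (\<lambda>y. of_bool (\<not> y k) :: real)" using insert by (auto simp: indep_def)
  ultimately have "Av S (\<lambda>y. of_bool (\<forall>j\<in>insert k S. \<not> y j)) =
      (\<lambda>y. of_bool (\<not> y k) * Av S (\<lambda>y. of_bool (\<forall>j\<in>S. \<not> y j)) y)"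
    using insert by (simp add: Av_mult_indep)
  then show ?case using insert by (simp add: Av_insert av_def)
qed simp

text \<open>
  Relaxation of the auxiliary chain that resamples the block \<open>B\<close>, and the block \<open>A\<close> whenever there is
  a 1 in \<open>S\<close>.
\<close>

lemma two_block:
  assumes fin: "finite A" "finite B" and disj: "A \<inter> B = {}" and S: "S \<subseteq> B" "S \<noteq> {}"
    and d: "d = sqrt (1 / 2 ^ card S)"
  shows "(1 - d) * Var (A \<union> B) f x \<le>
    Av (A \<union> B) (\<lambda>y. Var B f y + of_bool (\<exists>k\<in>S. y k) * Var A f y) x"
proof -
  let ?V = "A \<union> B" and ?E = "\<lambda>g. Av (A \<union> B) g x"
  let ?c = "\<lambda>y. of_bool (\<exists>k\<in>S. y k) :: real" and ?n = "\<lambda>y. of_bool (\<forall>k\<in>S. \<not> y k) :: real"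
  \<comment> \<open>\<open>h + G\<close> is the orthogonal splitting of
    \<open>f - Av (A \<union> B) f\<close> along \<open>B\<close>, while \<open>G + k\<close> is
    \<open>f - Av A f\<close>. \<open>G\<close> does not depend on \<open>B\<close>, and
    \<open>k\<close> has mean zero over \<open>B\<close>.\<close>
  define G where "G = (\<lambda>y. Av B f y - Av ?V f y)"
  define h where "h = (\<lambda>y. f y - Av B f y)"
  define k where "k = (\<lambda>y. h y - Av A h y)"
  have V: "finite ?V" using fin by simp
  have fS: "finite S" using fin S finite_subset by blast
  have cS: "1 \<le> card S" using fS S by (simp add: Suc_leI card_gt_0_iff)
  have d2: "d\<^sup>2 = 1 / 2 ^ card S" by (simp add: d)
  have d0: "0 < d" by (simp add: d)
  have "(2::real) ^ 1 \<le> 2 ^ card S" using cS by (rule power_increasing) simp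
  then have d1: "d < 1" by (simp add: d)
  have EA: "?E (Av A g) = ?E g" and EB: "?E (Av B g) = ?E g" for g
    using V by (simp_all add: Av_Av_subset)
  have iG: "indep B G"
    unfolding G_def using indep_Av[of B f] indep_subset[OF indep_Av[OF V, of f], of B] fin by (auto simp: indep_def)
  have ic: "indep A ?c"
  proof -
    have "(x(k := b)) j = x j" if "k \<in> A" "j \<in> S" for k j x and b :: bool
      using that S disj by auto
    then show ?thesis by (simp add: indep_def)
  qed
  have Bh: "Av B h = (\<lambda>_. 0)"
    unfolding h_def using fin by (auto simp: Av_diff Av_Av_subset)
  have Bk: "Av B k = (\<lambda>_. 0)"
  proof
    fix y
    have "Av B k y = Av B h y - Av B (Av A h) y" unfolding k_def using fin by (simp add: Av_diff)
    also have "Av B (Av A h) = Av A (Av B h)" by (rule Av_commute[OF fin(2,1)])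
    finally show "Av B k y = 0" using Bh fin by simp
  qed
  have Bn: "Av B ?n y = d\<^sup>2" for y
  proof -
    have "Av B ?n = Av B (Av S ?n)" using fin S by (simp add: Av_Av_subset)
    also have "Av S ?n = (\<lambda>_. d\<^sup>2)" using fS by (auto simp: Av_none d2)
    finally show ?thesis using fin by simp
  qed
  have cn: "?c y = 1 - ?n y" for y by auto
  have Bc: "Av B ?c y = 1 - d\<^sup>2" for y
    unfolding cn using fin Bn by (simp add: Av_diff)
  have EGB: "?E (\<lambda>y. r y * (G y)\<^sup>2) = z * ?E (\<lambda>y. (G y)\<^sup>2)" if "\<And>y. Av B r y = z" for r z
  proof -
    have "indep B (\<lambda>y. (G y)\<^sup>2)" using iG by (auto simp: indep_def)
    then have "Av B (\<lambda>y. (G y)\<^sup>2 * r y) = (\<lambda>y. (G y)\<^sup>2 * z)"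
      using fin that by (simp add: Av_mult_indep)
    then show ?thesis using EB[of "\<lambda>y. (G y)\<^sup>2 * r y"] V by (simp add: mult.commute Av_cmult)
  qed
  define X where "X = ?E (\<lambda>y. ?n y * (k y)\<^sup>2)"
  define Y where "Y = ?E (\<lambda>y. ?c y * (k y)\<^sup>2)"
  define Z where "Z = ?E (\<lambda>y. (G y)\<^sup>2)"
  define p where "p = ?E (\<lambda>y. ?c y * (G y * k y))"
  have EGk: "?E (\<lambda>y. G y * k y) = 0"
  proof -
    have "Av B (\<lambda>y. G y * k y) = (\<lambda>_. 0)" using fin iG Bk by (simp add: Av_mult_indep)
    then show ?thesis using EB[of "\<lambda>y. G y * k y"] V by simp
  qed
  \<comment> \<open>Since \<open>G\<close> and \<open>k\<close> are orthogonal, the integral over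
    the event of a 1 in \<open>S\<close> is minus that over its complement, which has probability
    \<open>d\<^sup>2\<close>. Cauchy-Schwarz on either event then bounds \<open>p\<close>.\<close>
  have p': "p = - ?E (\<lambda>y. ?n y * (G y * k y))"
  proof -
    have "p = ?E (\<lambda>y. G y * k y - ?n y * (G y * k y))"
      unfolding p_def cn by (simp add: algebra_simps)
    then show ?thesis using V EGk by (simp add: Av_diff)
  qed
  have cs: "(?E (\<lambda>y. r y * (G y * k y)))\<^sup>2 \<le> ?E (\<lambda>y. r y * (G y)\<^sup>2) * ?E (\<lambda>y. r y * (k y)\<^sup>2)"
    if "\<And>y. (r y)\<^sup>2 = r y" for r
  proof -
    have "r y * G y * (r y * k y) = (r y)\<^sup>2 * (G y * k y)" for y
      by (simp add: power2_eq_square)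
    then show ?thesis
      using Av_cauchy_schwarz[OF V, of "\<lambda>y. r y * G y" "\<lambda>y. r y * k y" x]
      by (simp only: power_mult_distrib that)
  qed
  have p1: "p\<^sup>2 \<le> (1 - d\<^sup>2) * Z * Y"
    using cs[of ?c] EGB[of ?c, OF Bc] unfolding p_def Y_def Z_def by simp
  have p2: "p\<^sup>2 \<le> d\<^sup>2 * Z * X"
    using cs[of ?n] EGB[of ?n, OF Bn] unfolding p' X_def Z_def by simp
  have nn: "0 \<le> X" "0 \<le> Y" "0 \<le> Z"
    unfolding X_def Y_def Z_def using V by (auto intro!: Av_nonneg)
  have key: "0 \<le> d * X + (1 + d) * Y + d * (1 - d) * Z + 2 * p"
    by (rule two_block_real) (use d0 d1 nn p1 p2 in auto)
  have EVB: "?E (Var B f) = ?E (\<lambda>y. (h y)\<^sup>2)"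
  proof -
    have "Av B (\<lambda>y. (h y)\<^sup>2) = Var B f"
      unfolding h_def by (rule ext) (rule Av_Var[OF fin(2)])
    then show ?thesis using EB[of "\<lambda>y. (h y)\<^sup>2"] by simp
  qed
  have VV: "Var ?V f x = ?E (\<lambda>y. (h y)\<^sup>2) + Z"
  proof -
    have "?E (\<lambda>y. G y * h y) = 0"
      using EB[of "\<lambda>y. G y * h y"] fin iG Bh V by (simp add: Av_mult_indep)
    moreover have "(\<lambda>y. (f y - Av ?V f y)\<^sup>2) = (\<lambda>y. ((h y)\<^sup>2 + (G y)\<^sup>2) + 2 * (G y * h y))"
      unfolding h_def G_def by (auto simp: power2_eq_square algebra_simps)
    then have "?E (\<lambda>y. (f y - Av ?V f y)\<^sup>2) = ?E (\<lambda>y. (h y)\<^sup>2) + Z + 2 * ?E (\<lambda>y. G y * h y)"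
      using V unfolding Z_def by (simp only: Av_add Av_cmult)
    ultimately show ?thesis using Av_Var[OF V, of f x] by simp
  qed
  have Ek: "X + Y \<le> ?E (\<lambda>y. (h y)\<^sup>2)"
  proof -
    have "X + Y = ?E (\<lambda>y. (k y)\<^sup>2)"
      unfolding X_def Y_def using V by (simp flip: Av_add add: cn algebra_simps)
    also have "\<dots> = ?E (Var A h)"
    proof -
      have "Av A (\<lambda>y. (k y)\<^sup>2) = Var A h"
        unfolding k_def by (rule ext) (rule Av_Var[OF fin(1)])
      then show ?thesis using EA[of "\<lambda>y. (k y)\<^sup>2"] by simp
    qed
    also have "\<dots> \<le> ?E (Av A (\<lambda>y. (h y)\<^sup>2))"
      using V by (intro Av_mono) (auto simp: Var_def)
    finally show ?thesis by (simp add: EA)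
  qed
  have Gk: "f y - Av A f y = G y + k y" for y
  proof -
    have "Av A h y = Av A f y - Av A (Av B f) y" unfolding h_def using fin by (simp add: Av_diff)
    then show ?thesis using fin unfolding G_def k_def by (simp add: Av_Un h_def)
  qed
  have EcA: "?E (\<lambda>y. ?c y * Var A f y) = (1 - d\<^sup>2) * Z + 2 * p + Y"
  proof -
    have "?E (\<lambda>y. ?c y * Var A f y) = ?E (Av A (\<lambda>y. ?c y * (f y - Av A f y)\<^sup>2))"
      using ic fin by (simp add: Av_mult_indep Av_Var)
    also have "\<dots> = ?E (\<lambda>y. ?c y * (G y + k y)\<^sup>2)" by (simp add: EA Gk)
    also have "(\<lambda>y. ?c y * (G y + k y)\<^sup>2) =
        (\<lambda>y. (?c y * (G y)\<^sup>2 + 2 * (?c y * (G y * k y))) + ?c y * (k y)\<^sup>2)"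
      by (auto simp: power2_eq_square algebra_simps)
    also have "?E \<dots> = ?E (\<lambda>y. ?c y * (G y)\<^sup>2) + 2 * p + Y"
      using V unfolding p_def Y_def by (simp only: Av_add Av_cmult)
    finally show ?thesis using EGB[of ?c, OF Bc] unfolding Z_def by simp
  qed
  \<comment> \<open>By \<open>Ek\<close>, the surplus of the right side of the next inequality over
    its left side dominates the quantity in \<open>key\<close>.\<close>
  have "d * (X + Y) \<le> d * ?E (\<lambda>y. (h y)\<^sup>2)" using Ek d0 by simp
  then have "(1 - d) * (?E (\<lambda>y. (h y)\<^sup>2) + Z) \<le> ?E (\<lambda>y. (h y)\<^sup>2) + ((1 - d\<^sup>2) * Z + 2 * p + Y)"
    using key by (simp add: algebra_simps power2_eq_square)
  then show ?thesis using V unfolding VV by (simp add: Av_add EVB EcA)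
qed

section \<open>Dirichlet form of the East model and bisection of intervals\<close>

definition local_var :: "nat \<Rightarrow> (config \<Rightarrow> real) \<Rightarrow> config \<Rightarrow> real" where
  "local_var k f x = (if x (Suc k) then Var {k} f x else 0)"

lemma local_var_nonneg: "0 \<le> local_var k f x"
  by (simp add: local_var_def Var_nonneg)

text \<open>Poincare inequality with a frozen 1 at site \<open>b\<close>, which is the constraint of
  the last site \<open>b - 1\<close>. All lengths up to \<open>L\<close> are included because the
  bisection produces intervals of varying length.\<close>

definition east_gap :: "real \<Rightarrow> nat \<Rightarrow> bool" where
  "east_gap \<gamma> L \<longleftrightarrow> (\<forall>a b f x. a \<le> b \<longrightarrow> b \<le> a + L \<longrightarrow> x b \<longrightarrow>
     \<gamma> * Var {a..<b} f x \<le> Av {a..<b} (\<lambda>y. \<Sum>k\<in>{a..<b}. local_var k f y) x)"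

lemma east_gapD:
  "east_gap \<gamma> L \<Longrightarrow> a \<le> b \<Longrightarrow> b \<le> a + L \<Longrightarrow> x b \<Longrightarrow>
     \<gamma> * Var {a..<b} f x \<le> Av {a..<b} (\<lambda>y. \<Sum>k\<in>{a..<b}. local_var k f y) x"
  by (simp add: east_gap_def)

lemma east_gap_mono:
  assumes "east_gap \<gamma> L" "\<gamma>' \<le> \<gamma>" "L' \<le> L"
  shows "east_gap \<gamma>' L'"
  unfolding east_gap_def
proof (intro allI impI)
  fix a b f x assume *: "a \<le> b" "b \<le> a + L'" "x b"
  have "\<gamma>' * Var {a..<b} f x \<le> \<gamma> * Var {a..<b} f x"
    using assms by (intro mult_right_mono Var_nonneg) auto
  then show "\<gamma>' * Var {a..<b} f x \<le> Av {a..<b} (\<lambda>y. \<Sum>k\<in>{a..<b}. local_var k f y) x"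
    using east_gapD[OF assms(1), of a b x f] * assms by linarith
qed

lemma east_gap_1: "east_gap 1 1"
  unfolding east_gap_def
proof (intro allI impI)
  fix a b :: nat and f x assume *: "a \<le> b" "b \<le> a + 1" "x b"
  then consider "b = a" | "b = Suc a" by linarith
  then show "1 * Var {a..<b} f x \<le> Av {a..<b} (\<lambda>y. \<Sum>k\<in>{a..<b}. local_var k f y) x"
  proof cases
    case 2
    have "av a (local_var a f) x = av a (Var {a} f) x"
      using *(3) 2 by (simp add: av_def local_var_def)
    also have "\<dots> = Var {a} f x"
      by (simp add: Var_def av_def)
    finally show ?thesis using 2 by simp
  qed (simp add: Var_def)
qed

text \<open>
  Here \<open>A = {a..<l}\<close>, \<open>B = {l..<b}\<close> and \<open>S = {l..<l + s}\<close>. If \<open>z\<close> is the rightmost 1 in \<open>S\<close>, then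
  \<open>Var A f\<close> is controlled by the gap on \<open>{a..<z}\<close>, and the event that \<open>z\<close> is rightmost only
  depends on sites outside this interval. The sites in \<open>{l..<l + s - 1}\<close> are counted twice.
\<close>

lemma two_block_east:
  assumes gap: "east_gap \<gamma> L" and \<gamma>: "0 \<le> \<gamma>"
    and s: "0 < s" and ab: "a \<le> l" "l + s \<le> b" "b \<le> l + L" "l + s \<le> Suc (a + L)" and xb: "x b"
  shows "\<gamma> * (1 - sqrt (1 / 2 ^ s)) * Var {a..<b} f x \<le>
    Av {a..<b} (\<lambda>y. \<Sum>k\<in>{a..<b}. local_var k f y) x +
    (\<Sum>k\<in>{l..<l + s - 1}. Av {a..<b} (local_var k f) x)"
proof -
  let ?A = "{a..<l}" and ?B = "{l..<b}" and ?S = "{l..<l + s}" and ?V = "{a..<b}"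
  let ?E = "\<lambda>g. Av ?V g x"
  let ?c = "\<lambda>y. of_bool (\<exists>k\<in>?S. y k) :: real"
  let ?i = "\<lambda>z y. of_bool (y z \<and> (\<forall>k\<in>{z<..<l + s}. \<not> y k)) :: real"
  have V: "?A \<union> ?B = ?V" using ab by auto
  have E: "?E (Av T g) = ?E g" if "T \<subseteq> ?V" for T g using that by (simp add: Av_Av_subset)
  have csum: "?c y = (\<Sum>z\<in>?S. ?i z y)" for y :: config
  proof (cases "\<exists>k\<in>?S. y k")
    case True
    define m where "m = Max {k \<in> ?S. y k}"
    have m: "m \<in> {k \<in> ?S. y k}" unfolding m_def using True by (intro Max_in) auto
    have le: "k \<le> m" if "k \<in> ?S" "y k" for k unfolding m_def using that by (intro Max_ge) auto
    have "?i z y = (if z = m then 1 else 0)" if z: "z \<in> ?S" for z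
    proof (cases "z = m")
      case True
      have "\<not> y k" if "k \<in> {m<..<l + s}" for k
        using le[of k] m that by (cases "y k") auto
      then show ?thesis using True m by auto
    next
      case False
      have "\<not> (y z \<and> (\<forall>k\<in>{z<..<l + s}. \<not> y k))"
      proof
        assume *: "y z \<and> (\<forall>k\<in>{z<..<l + s}. \<not> y k)"
        then have "z < m" using le[of z] z False by auto
        then show False using * m by auto
      qed
      then show ?thesis using False by simp
    qed
    then have "(\<Sum>z\<in>?S. ?i z y) = (\<Sum>z\<in>?S. if z = m then 1 else 0)" by (intro sum.cong) auto
    then show ?thesis using True m by simp
  qed (auto intro!: sum.neutral)
  have EB: "\<gamma> * ?E (Var ?B f) \<le> (\<Sum>k\<in>?B. ?E (local_var k f))"
  proof -
    have "\<gamma> * ?E (Var ?B f) = ?E (\<lambda>y. \<gamma> * Var ?B f y)" by (simp add: Av_cmult)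
    also have "\<dots> \<le> ?E (Av ?B (\<lambda>y. \<Sum>k\<in>?B. local_var k f y))"
      using xb ab by (intro Av_mono east_gapD[OF gap]) auto
    finally show ?thesis using ab by (simp add: E Av_sum)
  qed
  have Ei: "\<gamma> * ?E (\<lambda>y. ?i z y * Var ?A f y) \<le> ?E (\<lambda>y. ?i z y * (\<Sum>k\<in>{a..<l + s - 1}. local_var k f y))"
    if z: "z \<in> ?S" for z
  proof -
    let ?Z = "{a..<z}"
    have sub: "?A \<subseteq> ?Z" "?Z \<subseteq> ?V" using z ab by auto
    have ind: "indep ?Z (?i z)" using z by (auto simp: indep_def)
    have av_i: "?E (\<lambda>y. ?i z y * Av ?Z g y) = ?E (\<lambda>y. ?i z y * g y)" for g
      using E[OF sub(2), of "\<lambda>y. ?i z y * g y"] ind by (simp add: Av_mult_indep)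
    have "\<gamma> * ?E (\<lambda>y. ?i z y * Var ?A f y) = ?E (\<lambda>y. ?i z y * Av ?Z (Var ?A f) y) * \<gamma>"
      by (simp add: av_i)
    also have "\<dots> \<le> ?E (\<lambda>y. ?i z y * Var ?Z f y) * \<gamma>"
      using \<gamma> sub by (intro mult_right_mono Av_mono mult_left_mono Av_Var_subset) auto
    also have "\<dots> = ?E (\<lambda>y. ?i z y * (\<gamma> * Var ?Z f y))"
      by (simp flip: Av_cmult add: mult_ac)
    also have "\<dots> \<le> ?E (\<lambda>y. ?i z y * Av ?Z (\<lambda>y. \<Sum>k\<in>?Z. local_var k f y) y)"
    proof (intro Av_mono)
      fix y :: config
      show "?i z y * (\<gamma> * Var ?Z f y) \<le> ?i z y * Av ?Z (\<lambda>y. \<Sum>k\<in>?Z. local_var k f y) y"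
        \<comment> \<open>As \<open>z \<le> l + s - 1\<close>, the hypothesis with
          \<open>Suc (a + L)\<close> just keeps \<open>{a..<z}\<close> within length
          \<open>L\<close>.\<close>
        using east_gapD[OF gap, of a z y f] z ab by (cases "y z") auto
    qed simp
    also have "\<dots> = ?E (\<lambda>y. ?i z y * (\<Sum>k\<in>?Z. local_var k f y))" by (rule av_i)
    also have "\<dots> \<le> ?E (\<lambda>y. ?i z y * (\<Sum>k\<in>{a..<l + s - 1}. local_var k f y))"
      using z by (intro Av_mono mult_left_mono sum_mono2 local_var_nonneg) auto
    finally show ?thesis .
  qed
  have EA: "\<gamma> * ?E (\<lambda>y. ?c y * Var ?A f y) \<le> (\<Sum>k\<in>{a..<l + s - 1}. ?E (local_var k f))"
  proof -
    have "\<gamma> * ?E (\<lambda>y. ?c y * Var ?A f y) = (\<Sum>z\<in>?S. \<gamma> * ?E (\<lambda>y. ?i z y * Var ?A f y))"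
      unfolding csum by (simp only: sum_distrib_right Av_sum sum_distrib_left finite_atLeastLessThan)
    also have "\<dots> \<le> (\<Sum>z\<in>?S. ?E (\<lambda>y. ?i z y * (\<Sum>k\<in>{a..<l + s - 1}. local_var k f y)))"
      by (intro sum_mono Ei)
    also have "\<dots> = ?E (\<lambda>y. ?c y * (\<Sum>k\<in>{a..<l + s - 1}. local_var k f y))"
      unfolding csum by (simp only: sum_distrib_right Av_sum finite_atLeastLessThan)
    also have "\<dots> \<le> ?E (\<lambda>y. 1 * (\<Sum>k\<in>{a..<l + s - 1}. local_var k f y))"
      by (intro Av_mono mult_right_mono sum_nonneg local_var_nonneg) auto
    finally show ?thesis by (simp add: Av_sum)
  qed
  have "(1 - sqrt (1 / 2 ^ s)) * Var ?V f x \<le> ?E (Var ?B f) + ?E (\<lambda>y. ?c y * Var ?A f y)"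
    using two_block[of ?A ?B ?S "sqrt (1 / 2 ^ s)" f x] ab s unfolding V by (simp add: Av_add)
  then have "\<gamma> * ((1 - sqrt (1 / 2 ^ s)) * Var ?V f x) \<le> \<gamma> * (?E (Var ?B f) + ?E (\<lambda>y. ?c y * Var ?A f y))"
    using \<gamma> by (rule mult_left_mono)
  also have "\<dots> \<le> (\<Sum>k\<in>?B. ?E (local_var k f)) + (\<Sum>k\<in>{a..<l + s - 1}. ?E (local_var k f))"
    using EA EB by (simp add: distrib_left)
  also have "(\<Sum>k\<in>{a..<l + s - 1}. ?E (local_var k f)) =
      (\<Sum>k\<in>?A. ?E (local_var k f)) + (\<Sum>k\<in>{l..<l + s - 1}. ?E (local_var k f))"
    using ab s by (simp add: sum.atLeastLessThan_concat)
  also have "(\<Sum>k\<in>?B. ?E (local_var k f)) + ((\<Sum>k\<in>?A. ?E (local_var k f)) + (\<Sum>k\<in>{l..<l + s - 1}. ?E (local_var k f)))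
     = (\<Sum>k\<in>?V. ?E (local_var k f)) + (\<Sum>k\<in>{l..<l + s - 1}. ?E (local_var k f))"
    using ab sum.atLeastLessThan_concat[of a l b "\<lambda>k. ?E (local_var k f)"] by simp
  finally show ?thesis by (simp add: Av_sum mult.assoc)
qed

text \<open>
  Averaging the previous bound over \<open>r\<close> disjoint positions of \<open>S\<close> reduces the overcounting to a factor
  \<open>1 + 1 / r\<close>.
\<close>

lemma east_gap_step:
  assumes gap: "east_gap \<gamma> L" and \<gamma>: "0 \<le> \<gamma>"
    and s: "0 < s" and r: "0 < r" and rs: "r * s \<le> L"
  shows "east_gap (\<gamma> * (1 - sqrt (1 / 2 ^ s)) * (real r / (real r + 1))) (2 * L + 1 - r * s)"
  unfolding east_gap_def
proof (intro allI impI)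
  fix a b :: nat and f x assume ab: "a \<le> b" "b \<le> a + (2 * L + 1 - r * s)" and xb: "x b"
  let ?V = "{a..<b}"
  let ?d = "sqrt (1 / 2 ^ s) :: real"
  let ?D = "\<lambda>k. Av ?V (local_var k f) x"
  let ?T = "Av ?V (\<lambda>y. \<Sum>k\<in>?V. local_var k f y) x"
  have d: "0 \<le> ?d" "?d \<le> 1" by auto
  have nn: "0 \<le> Var ?V f x" by (simp add: Var_nonneg)
  have T: "?T = (\<Sum>k\<in>?V. ?D k)" by (simp add: Av_sum)
  show "\<gamma> * (1 - ?d) * (real r / (real r + 1)) * Var ?V f x \<le> ?T"
  proof (cases "b \<le> a + L")
    case True
    have "(1 - ?d) * (real r / (real r + 1)) \<le> 1 * 1" using d by (intro mult_mono) auto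
    then have "\<gamma> * ((1 - ?d) * (real r / (real r + 1))) \<le> \<gamma> * 1" using \<gamma> by (intro mult_left_mono) auto
    then have "\<gamma> * (1 - ?d) * (real r / (real r + 1)) * Var ?V f x \<le> \<gamma> * Var ?V f x"
      using nn by (intro mult_right_mono) (auto simp: mult.assoc)
    then show ?thesis using east_gapD[of \<gamma> L a b x f] gap ab(1) True xb by linarith
  next
    case False
    \<comment> \<open>Each \<open>{l i..<b}\<close> has length at most \<open>L\<close>, and
      \<open>l i + s \<le> b - L + r * s \<le> a + L + 1\<close>; the latter bound is what limits
      the new length to \<open>2 * L + 1 - r * s\<close>. The subtraction is proper because
      \<open>b > a + L\<close>.\<close>
    define l where "l i = b - L + i * s" for i
    have l: "l i + s \<le> b - L + r * s" if "i < r" for i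
    proof -
      have "(i + 1) * s \<le> r * s" using that by (intro mult_right_mono) auto
      then show ?thesis by (simp add: l_def)
    qed
    have Lb: "L \<le> b" using False by simp
    have *: "\<gamma> * (1 - ?d) * Var ?V f x \<le> ?T + (\<Sum>k\<in>{l i..<l i + s - 1}. ?D k)" if "i < r" for i
    proof (rule two_block_east[OF gap \<gamma> s])
      show "l i + s \<le> b" "l i + s \<le> Suc (a + L)" using l[OF that] rs Lb ab by linarith+
      show "a \<le> l i" "b \<le> l i + L" using False by (auto simp: l_def)
    qed fact
    have disj: "(\<Sum>i<r. \<Sum>k\<in>{l i..<l i + s - 1}. ?D k) \<le> ?T"
    proof -
      have "(\<Sum>i<r. \<Sum>k\<in>{l i..<l i + s - 1}. ?D k) \<le> (\<Sum>i<r. \<Sum>k\<in>{l i..<l i + s}. ?D k)"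
        by (intro sum_mono sum_mono2) (auto intro!: Av_nonneg local_var_nonneg)
      also have "\<dots> = (\<Sum>k\<in>(\<Union>i<r. {l i..<l i + s}). ?D k)"
      proof (subst sum.UNION_disjoint)
        have dd: "{l i..<l i + s} \<inter> {l j..<l j + s} = {}" if "i < j" for i j
        proof -
          have "(i + 1) * s \<le> j * s" using that by (intro mult_right_mono) auto
          then have "l i + s \<le> l j" by (simp add: l_def)
          then show ?thesis by auto
        qed
        then show "\<forall>i\<in>{..<r}. \<forall>j\<in>{..<r}. i \<noteq> j \<longrightarrow> {l i..<l i + s} \<inter> {l j..<l j + s} = {}"
          by (metis Int_commute linorder_neqE_nat)
      qed auto
      also have "\<dots> \<le> (\<Sum>k\<in>?V. ?D k)"
      proof (rule sum_mono2)
        show "(\<Union>i<r. {l i..<l i + s}) \<subseteq> ?V"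
        proof
          fix k assume "k \<in> (\<Union>i<r. {l i..<l i + s})"
          then obtain i where i: "i < r" "l i \<le> k" "k < l i + s" by auto
          then show "k \<in> ?V" using l[OF i(1)] rs Lb False by (auto simp: l_def)
        qed
      qed (auto intro!: Av_nonneg local_var_nonneg)
      finally show ?thesis by (simp add: T)
    qed
    have "real r * (\<gamma> * (1 - ?d) * Var ?V f x) = (\<Sum>i<r. \<gamma> * (1 - ?d) * Var ?V f x)" by simp
    also have "\<dots> \<le> (\<Sum>i<r. ?T + (\<Sum>k\<in>{l i..<l i + s - 1}. ?D k))" using * by (intro sum_mono) auto
    also have "\<dots> \<le> real r * ?T + ?T" using disj by (simp add: sum.distrib)
    finally have "r * (\<gamma> * (1 - ?d) * Var ?V f x) \<le> (real r + 1) * ?T" by (simp add: distrib_right)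
    then show ?thesis by (simp add: field_simps)
  qed
qed

text \<open>Too lossy to iterate over all scales, but good enough to reach the first scale of
  \<open>east_gap_scales\<close>.\<close>

lemma east_gap_double:
  assumes gap: "east_gap \<gamma> L" and "0 \<le> \<gamma>" "0 < L"
  shows "east_gap (\<gamma> * ((1 - sqrt (1 / 2)) / 2)) (2 * L)"
  using east_gap_step[OF assms(1,2), of 1 1] assms(3) by simp

text \<open>
  With \<open>s = 4 j\<close> and \<open>r = j\<^sup>2\<close> each step loses at most the factor \<open>(1 - 1 / j\<^sup>2)\<^sup>2\<close>, whose product telescopes
  to the stated one.
\<close>

lemma east_gap_scales:
  assumes "east_gap c (16 * 5 ^ 3)" "0 < c" "5 \<le> j"
  shows "east_gap (c * (4 / 5)\<^sup>2 * (real j / (real j - 1))\<^sup>2) (16 * j ^ 3)"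
  using assms(3)
proof (induction j rule: dec_induct)
  case base
  \<comment> \<open>At \<open>j = 5\<close> the factor \<open>(4 / 5)\<^sup>2\<close> cancels
    \<open>(5 / 4)\<^sup>2\<close>.\<close>
  then show ?case using assms by (simp add: power2_eq_square)
next
  case (step j)
  let ?g = "c * (4 / 5)\<^sup>2 * (real j / (real j - 1))\<^sup>2"
  let ?d = "sqrt (1 / 2 ^ (4 * j)) :: real"
  have j: "5 \<le> real j" using step by simp
  have g: "0 \<le> ?g" using assms by simp
  have rs: "j\<^sup>2 * (4 * j) = 4 * j ^ 3" by (simp add: power2_eq_square power3_eq_cube)
  have main: "east_gap (?g * (1 - ?d) * (real (j\<^sup>2) / (real (j\<^sup>2) + 1))) (2 * (16 * j ^ 3) + 1 - 4 * j ^ 3)"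
    using east_gap_step[OF step.IH g, of "4 * j" "j\<^sup>2"] step unfolding rs by (simp add: add.commute)
  \<comment> \<open>This amounts to \<open>48 * j ^ 2 + 48 * j + 15 \<le> 12 * j ^ 3\<close>, which
    fails at 4 and holds from 5 on; hence the starting scale.\<close>
  have len: "16 * (Suc j) ^ 3 \<le> 2 * (16 * j ^ 3) + 1 - 4 * j ^ 3"
  proof -
    have "5 * (j * j) \<le> j * (j * j)" using step by (intro mult_right_mono) auto
    moreover have "5 * j \<le> j * j" using step by (intro mult_right_mono) auto
    moreover have "16 * (Suc j) ^ 3 = 16 * (j * (j * j)) + 48 * (j * j) + 48 * j + 16"
      by (simp add: power3_eq_cube algebra_simps)
    moreover have "j ^ 3 = j * (j * j)" by (simp add: power3_eq_cube)
    ultimately show ?thesis using step(1) by linarith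
  qed
  have d: "?d \<le> 1 / (real j)\<^sup>2"
  proof -
    have "?d = 1 / 2 ^ (2 * j)"
      by (rule real_sqrt_unique) (simp_all add: power_divide power_mult[symmetric] mult.commute)
    also have "\<dots> = 1 / (2 ^ j)\<^sup>2" by (simp add: power_mult[symmetric] mult.commute)
    also have "\<dots> \<le> 1 / (real j)\<^sup>2"
    proof -
      have "real j \<le> 2 ^ j" using of_nat_mono[OF less_imp_le[OF less_exp[of j]], where 'a = real] by simp
      then show ?thesis using j by (intro divide_left_mono power_mono) auto
    qed
    finally show ?thesis .
  qed
  have q: "1 - 1 / (real j)\<^sup>2 \<le> real (j\<^sup>2) / (real (j\<^sup>2) + 1)"
    using j by (simp add: field_simps add_pos_pos)
  have one: "1 / (real j)\<^sup>2 \<le> 1" using j by (simp add: field_simps)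
  have "(1 - 1 / (real j)\<^sup>2) * (1 - 1 / (real j)\<^sup>2) \<le> (1 - ?d) * (real (j\<^sup>2) / (real (j\<^sup>2) + 1))"
    using d q one by (intro mult_mono) auto
  then have "?g * ((1 - 1 / (real j)\<^sup>2) * (1 - 1 / (real j)\<^sup>2)) \<le> ?g * ((1 - ?d) * (real (j\<^sup>2) / (real (j\<^sup>2) + 1)))"
    using g by (rule mult_left_mono)
  moreover have "(real j / (real j - 1))\<^sup>2 * ((1 - 1 / (real j)\<^sup>2) * (1 - 1 / (real j)\<^sup>2)) =
      (real (Suc j) / (real (Suc j) - 1))\<^sup>2"
  proof -
    have "(real j / (real j - 1)) * (1 - 1 / (real j)\<^sup>2) = real (Suc j) / (real (Suc j) - 1)"
      using j by (simp add: field_simps power2_eq_square)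
    then show ?thesis by (metis power_mult_distrib power2_eq_square)
  qed
  ultimately show ?case
    by (intro east_gap_mono[OF main _ len]) (simp add: mult.assoc)
qed

lemma east_gap_uniform: "\<exists>c>0. \<forall>L. east_gap c L"
proof -
  define q where "q = (1 - sqrt (1 / 2)) / (2::real)"
  have q: "0 < q" by (simp add: q_def)
  have "east_gap (q ^ i) (2 ^ i)" for i
  proof (induction i)
    case (Suc i)
    then show ?case using east_gap_double[of "q ^ i" "2 ^ i"] q by (simp add: q_def[symmetric] mult.commute)
  qed (use east_gap_1 in simp)
  \<comment> \<open>\<open>2 ^ 11 = 2048\<close> exceeds \<open>16 * 5 ^ 3 = 2000\<close>.\<close>
  from this[of 11] have base: "east_gap (q ^ 11) (16 * 5 ^ 3)" by (rule east_gap_mono) auto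
  let ?c = "q ^ 11 * (4 / 5)\<^sup>2"
  have "east_gap ?c L" for L
  proof -
    define j where "j = L + 5"
    have "east_gap (?c * (real j / (real j - 1))\<^sup>2) (16 * j ^ 3)"
      using q by (intro east_gap_scales[OF base]) (auto simp: j_def)
    then show ?thesis
    proof (rule east_gap_mono)
      have "1 \<le> (real j / (real j - 1))\<^sup>2" by (auto simp: j_def field_simps intro!: one_le_power)
      then have "?c * 1 \<le> ?c * (real j / (real j - 1))\<^sup>2" using q by (intro mult_left_mono) auto
      then show "?c \<le> ?c * (real j / (real j - 1))\<^sup>2" by simp
      have "j ^ 1 \<le> j ^ 3" by (rule power_increasing) (auto simp: j_def)
      then show "L \<le> 16 * j ^ 3" by (simp add: j_def)
    qed
  qed
  moreover have "0 < ?c" using q by simp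
  ultimately show ?thesis by blast
qed

section \<open>The killed East model\<close>

text \<open>Backward operator of the East model, killed when an allowed update hits
  \<open>r\<close>. Updates left of \<open>r\<close> are idle, as they never influence sites from
  \<open>r\<close> on.\<close>

definition killed_step :: "nat \<Rightarrow> nat \<Rightarrow> (config \<Rightarrow> real) \<Rightarrow> config \<Rightarrow> real" where
  "killed_step r k u x =
     (if k < r \<or> \<not> x (Suc k) then u x else if k = r then 0 else av k u x)"

primrec survival :: "nat \<Rightarrow> nat \<Rightarrow> nat \<Rightarrow> config \<Rightarrow> real" where
  "survival m r 0 = (\<lambda>x. 1)"
| "survival m r (Suc t) = (\<lambda>x. (\<Sum>k<m. killed_step r k (survival m r t) x) / m)"

text \<open>Site \<open>r\<close> is the constraint only of \<open>r - 1\<close>, whose update is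
  idle, and an update at \<open>r\<close> itself kills or does nothing.\<close>

lemma indep_survival: "indep {r} (survival m r t)"
proof (induction t)
  case (Suc t)
  have "killed_step r k (survival m r t) (x(r := b)) = killed_step r k (survival m r t) x" for k x b
  proof -
    have "x(r := b, k := c) = x(k := c, r := b)" if "k \<noteq> r" for c using that by (simp add: fun_upd_twist)
    then show ?thesis using Suc by (auto simp: killed_step_def av_def indep_def)
  qed
  then show ?case by (simp add: indep_def)
qed (simp add: indep_def)

text \<open>
  The odd extension \<open>f\<close> of \<open>u\<close> in the coordinate \<open>r\<close> has mean zero, so killing at \<open>r\<close> is
  resampling of that coordinate, and the gap on \<open>{r..<j}\<close> applies to \<open>f\<close>.
\<close>

lemma killed_form_lower:
  assumes gap: "east_gap \<gamma> L" and r: "r < j" "j \<le> r + L" and xj: "x j" and u: "indep {r} u"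
  shows "\<gamma> * Av {r<..<j} (\<lambda>y. (u y)\<^sup>2) x \<le>
    Av {r<..<j} (\<lambda>y. if y (Suc r) then (u y)\<^sup>2 else 0) x + (\<Sum>k\<in>{r<..<j}. Av {r<..<j} (local_var k u) x)"
proof -
  let ?S = "{r<..<j}" and ?V = "{r..<j}"
  define f where "f x = (if x r then - u x else u x)" for x
  have V: "?V = insert r ?S" using r by auto
  have u': "u (y(r := b)) = u y" for y b using u by (simp add: indep_def)
  have AvV: "Av ?V g = Av ?S (av r g)" for g by (simp add: V Av_insert2)
  have f2: "(f y)\<^sup>2 = (u y)\<^sup>2" for y by (simp add: f_def)
  have avf: "av r f = (\<lambda>_. 0)" by (auto simp: av_def f_def u')
  have avu2: "av r (\<lambda>y. (u y)\<^sup>2) = (\<lambda>y. (u y)\<^sup>2)" by (auto simp: av_def u')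
  have Varf: "Var ?V f x = Av ?S (\<lambda>y. (u y)\<^sup>2) x"
    by (simp add: Var_def AvV avf f2 avu2)
  have Dr: "local_var r f = (\<lambda>y. if y (Suc r) then (u y)\<^sup>2 else 0)"
    by (auto simp: local_var_def Var_def avf f2 avu2)
  have Dk: "local_var k f = local_var k u" if "k \<in> ?S" for k
  proof
    fix y
    have "(av k f y)\<^sup>2 = (av k u y)\<^sup>2"
      using that by (cases "y r") (auto simp: av_def f_def power2_eq_square algebra_simps)
    then show "local_var k f y = local_var k u y" by (simp add: local_var_def Var_def f2)
  qed
  have avDr: "av r (local_var r f) = local_var r f" by (auto simp: Dr av_def u')
  have avDk: "av r (local_var k u) = local_var k u" if "k \<in> ?S" for k
  proof (intro av_indep)
    have "y(r := b, k := c) = y(k := c, r := b)" for y :: config and b c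
      using that by (simp add: fun_upd_twist)
    then show "indep {r} (local_var k u)"
      using that by (auto simp: indep_def local_var_def Var_def av_def u')
  qed
  have "\<gamma> * Av ?S (\<lambda>y. (u y)\<^sup>2) x \<le> (\<Sum>k\<in>?V. Av ?V (local_var k f) x)"
    using east_gapD[of \<gamma> L r j x f] gap r xj by (simp add: Varf Av_sum)
  also have "\<dots> = Av ?V (local_var r f) x + (\<Sum>k\<in>?S. Av ?V (local_var k f) x)"
    by (simp add: V)
  also have "Av ?V (local_var r f) x = Av ?S (local_var r f) x" by (simp add: AvV avDr)
  also have "(\<Sum>k\<in>?S. Av ?V (local_var k f) x) = (\<Sum>k\<in>?S. Av ?S (local_var k u) x)"
    by (intro sum.cong) (auto simp: AvV Dk avDk)
  finally show ?thesis by (simp add: Dr)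
qed

text \<open>Each single update is an orthogonal projection, so it lowers the mean square by exactly
  its Dirichlet term \<open>?e k\<close>. Convexity of the square passes the mean loss on to the
  averaged step.\<close>

lemma killed_contraction:
  assumes gap: "east_gap \<gamma> L" and r: "r < j" "j \<le> r + L" "j \<le> m"
    and x: "x j" "\<And>k. j < k \<Longrightarrow> \<not> x k" and u: "indep {r} u"
  shows "Av {r<..<j} (\<lambda>y. ((\<Sum>k<m. killed_step r k u y) / m)\<^sup>2) x \<le>
    (1 - \<gamma> / m) * Av {r<..<j} (\<lambda>y. (u y)\<^sup>2) x"
proof -
  let ?S = "{r<..<j}"
  let ?q = "\<lambda>k y. (killed_step r k u y)\<^sup>2"
  let ?N = "Av ?S (\<lambda>y. (u y)\<^sup>2) x"
  let ?e = "\<lambda>k. if k = r then Av ?S (\<lambda>y. if y (Suc r) then (u y)\<^sup>2 else 0) x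
    else if k \<in> ?S then Av ?S (local_var k u) x else 0"
  have m: "0 < m" using r by simp
  have step: "Av ?S (?q k) x = ?N - ?e k" for k
  proof -
    consider "k < r" | "k = r" | "k \<in> ?S" | "j \<le> k" using r by fastforce
    then show ?thesis
    proof cases
      case 1
      then show ?thesis by (simp add: killed_step_def)
    next
      case 2
      have "?q k = (\<lambda>y. (u y)\<^sup>2 - (if y (Suc r) then (u y)\<^sup>2 else 0))"
        using 2 by (auto simp: killed_step_def)
      then show ?thesis using 2 by (simp add: Av_diff)
    next
      case 3
      let ?c = "\<lambda>y. of_bool (y (Suc k)) :: real"
      have c: "indep {k} ?c" by (simp add: indep_def)
      \<comment> \<open>The last bracket has mean zero, since the constraint at \<open>Suc k\<close>
        does not read site \<open>k\<close>.\<close>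
      have eq: "?q k = (\<lambda>y. (u y)\<^sup>2 - local_var k u y - (?c y * (u y)\<^sup>2 - ?c y * av k (\<lambda>y. (u y)\<^sup>2) y))"
        using 3 by (auto simp: killed_step_def local_var_def Var_def)
      have "Av ?S (\<lambda>y. ?c y * (u y)\<^sup>2) = Av ?S (av k (\<lambda>y. ?c y * (u y)\<^sup>2))"
        using 3 by (simp add: Av_av_in)
      also have "av k (\<lambda>y. ?c y * (u y)\<^sup>2) = (\<lambda>y. ?c y * av k (\<lambda>y. (u y)\<^sup>2) y)"
        by (auto simp: av_def)
      finally show ?thesis using 3 unfolding eq by (simp add: Av_diff)
    next
      case 4
      \<comment> \<open>All sites beyond \<open>j\<close> are frozen at 0, so no update from
        \<open>j\<close> on is allowed.\<close>
      have "Av ?S (?q k) x = ?N"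
      proof (rule Av_cong)
        fix y assume "\<And>k. k \<notin> ?S \<Longrightarrow> y k = x k"
        then have "\<not> y (Suc k)" using x(2)[of "Suc k"] 4 by auto
        then show "?q k y = (u y)\<^sup>2" by (simp add: killed_step_def)
      qed simp
      then show ?thesis using 4 r by simp
    qed
  qed
  have "Av ?S (\<lambda>y. ((\<Sum>k<m. killed_step r k u y) / m)\<^sup>2) x \<le> Av ?S (\<lambda>y. (1 / m) * (\<Sum>k<m. ?q k y)) x"
  proof (intro Av_mono)
    fix y :: config
    have "(\<Sum>k<m. killed_step r k u y)\<^sup>2 \<le> (\<Sum>k<m. ?q k y) * m"
      using sum_squared_le_sum_of_squares[of "\<lambda>k. killed_step r k u y" "{..<m}"] by simp
    then show "((\<Sum>k<m. killed_step r k u y) / m)\<^sup>2 \<le> (1 / m) * (\<Sum>k<m. ?q k y)"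
      using m by (simp add: power2_eq_square field_simps)
  qed simp
  also have "\<dots> = (1 / m) * (\<Sum>k<m. ?N - ?e k)"
    by (simp only: Av_cmult Av_sum step finite_greaterThanLessThan finite_lessThan)
  also have "(\<Sum>k<m. ?N - ?e k) = m * ?N - (\<Sum>k<m. ?e k)" by (simp add: sum_subtractf)
  also have "(\<Sum>k<m. ?e k) = (\<Sum>k\<in>insert r ?S. ?e k)"
    using r by (intro sum.mono_neutral_right) auto
  also have "\<dots> = ?e r + (\<Sum>k\<in>?S. Av ?S (local_var k u) x)" by simp
  also have "(1 / m) * (m * ?N - \<dots>) \<le> (1 / m) * (m * ?N - \<gamma> * ?N)"
    using killed_form_lower[where x = x, OF gap r(1,2) x(1) u] by (intro mult_left_mono diff_left_mono) auto
  also have "\<dots> = (1 - \<gamma> / m) * ?N" using m by (simp add: field_simps)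
  finally show ?thesis .
qed

text \<open>The mean square decays from its initial value 1; \<open>Av_lower\<close> then trades it
  for the value at \<open>x\<close>, at a cost of at most \<open>2 ^ m\<close>.\<close>

lemma survival_bound:
  assumes gap: "east_gap \<gamma> m" and \<gamma>: "0 < \<gamma>" "\<gamma> \<le> 1" and r: "r < j" "j \<le> m"
    and x: "x j" "\<And>k. j < k \<Longrightarrow> \<not> x k"
  shows "(survival m r t x)\<^sup>2 \<le> 2 ^ m * exp (- \<gamma> * t / m)"
proof -
  let ?S = "{r<..<j}" and ?N = "\<lambda>t. Av {r<..<j} (\<lambda>y. (survival m r t y)\<^sup>2) x"
  have m: "0 < m" using r by simp
  have "?N t \<le> (1 - \<gamma> / m) ^ t"
  proof (induction t)
    case (Suc t)
    have "?N (Suc t) \<le> (1 - \<gamma> / m) * ?N t"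
      using killed_contraction[where x = x, OF gap r(1) _ r(2) x indep_survival[of r m t]] r by simp
    \<comment> \<open>\<open>\<gamma> \<le> 1\<close> keeps the factor nonnegative.\<close>
    also have "\<dots> \<le> (1 - \<gamma> / m) * (1 - \<gamma> / m) ^ t"
      using Suc \<gamma> m by (intro mult_left_mono) (auto simp: field_simps)
    finally show ?case by simp
  qed simp
  also have "\<dots> \<le> exp (- \<gamma> / m) ^ t"
    using \<gamma> m exp_ge_add_one_self[of "- \<gamma> / m"] by (intro power_mono) (auto simp: field_simps)
  also have "\<dots> = exp (- \<gamma> * t / m)" by (simp flip: exp_of_nat_mult)
  finally have N: "?N t \<le> exp (- \<gamma> * t / m)" .
  have "(survival m r t x)\<^sup>2 \<le> 2 ^ card ?S * ?N t"
    by (rule Av_lower[where f = "\<lambda>y. (survival m r t y)\<^sup>2"]) auto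
  also have "\<dots> \<le> 2 ^ m * exp (- \<gamma> * t / m)"
    using r N by (intro mult_mono power_increasing Av_nonneg) auto
  finally show ?thesis .
qed

section \<open>Characters of a row\<close>

declare add_bit_eq_xor [simp del] mult_bit_eq_and [simp del]

lemma bit_add_self [simp]: "(b::bit) + b = 0"
  by (cases b) auto

lemma bit_add_self_left [simp]: "(b::bit) + (b + c) = c"
  by (simp flip: add.assoc)

abbreviation upper_group :: "nat \<Rightarrow> bit mat set" where
  "upper_group n \<equiv> carrier (unitri_group n)"

text \<open>For \<open>w\<close> vanishing up to \<open>r\<close>, a translation of the free entries
  of row \<open>r\<close>; these form the abelian group whose characters are used.\<close>

definition add_to_row :: "nat \<Rightarrow> (nat \<Rightarrow> bit) \<Rightarrow> bit mat \<Rightarrow> bit mat" where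
  "add_to_row r w M = mat (dim_row M) (dim_col M) (\<lambda>(i, j). M $$ (i, j) + (if i = r then w j else 0))"

abbreviation row_op :: "nat \<Rightarrow> bit mat \<Rightarrow> bit mat" where
  "row_op k M \<equiv> addrow 1 k (Suc k) M"

lemma add_to_row_unitri:
  "M \<in> upper_group n \<Longrightarrow> (\<And>c. c \<le> j \<Longrightarrow> w c = 0) \<Longrightarrow> add_to_row j w M \<in> upper_group n"
  by (auto simp: carrier_unitri add_to_row_def)

lemma add_to_row_commute: "add_to_row i v (add_to_row j w M) = add_to_row j w (add_to_row i v M)"
  by (intro eq_matI) (auto simp: add_to_row_def)

lemma add_to_row_add: "add_to_row j v (add_to_row j w M) = add_to_row j (\<lambda>c. v c + w c) M"
  by (intro eq_matI) (auto simp: add_to_row_def)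

lemma add_to_row_zero: "add_to_row j (\<lambda>c. 0) M = M"
  by (intro eq_matI) (auto simp: add_to_row_def)

lemma row_op_unitri: "M \<in> upper_group n \<Longrightarrow> k < n - 1 \<Longrightarrow> row_op k M \<in> upper_group n"
  using addrow_unitri[of M n "Suc k" 1] by simp

lemma row_op_eq_add_to_row: "row_op k M = add_to_row k (\<lambda>c. M $$ (Suc k, c)) M"
  by (intro eq_matI) (auto simp: add_to_row_def add.commute)

lemma row_op_add_to_row:
  assumes "M \<in> upper_group n" "k < n - 1"
  shows "row_op k (add_to_row j w M) =
    (if j = Suc k then add_to_row k w (add_to_row j w (row_op k M)) else add_to_row j w (row_op k M))"
  using assms by (intro eq_matI) (auto simp: add_to_row_def carrier_unitri)

lemma row_below_zero:
  "M \<in> upper_group n \<Longrightarrow> k < n \<Longrightarrow> c < k \<Longrightarrow> M $$ (k, c) = 0"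
  by (auto simp: carrier_unitri)

definition sg :: "bit \<Rightarrow> real" where
  "sg b = (if b = 1 then - 1 else 1)"

lemma sg_0 [simp]: "sg 0 = 1" and sg_1 [simp]: "sg 1 = - 1"
  by (simp_all add: sg_def)

lemma sg_add: "sg (a + b) = sg a * sg b"
  by (cases a; cases b) auto

lemma abs_sg [simp]: "\<bar>sg b\<bar> = 1"
  by (simp add: sg_def)

lemma sg_sum: "finite V \<Longrightarrow> sg (\<Sum>c\<in>V. w c) = (\<Prod>c\<in>V. sg (w c))"
  by (induction V rule: finite_induct) (auto simp: sg_add)

text \<open>Joint eigenfunctions of these translations: trivial character on the rows above
  \<open>r\<close>, that of \<open>V\<close> on row \<open>r\<close>. Dependence on later rows is
  left free, so that the walk preserves the class.\<close>

definition row_char :: "nat \<Rightarrow> nat \<Rightarrow> nat set \<Rightarrow> (bit mat \<Rightarrow> real) \<Rightarrow> bool" where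
  "row_char n r V h \<longleftrightarrow> (\<forall>M\<in>upper_group n. \<forall>j\<le>r. \<forall>w. (\<forall>c\<le>j. w c = 0) \<longrightarrow>
     h (add_to_row j w M) = (if j = r then sg (\<Sum>c\<in>V. w c) else 1) * h M)"

lemma row_charD:
  "row_char n r V h \<Longrightarrow> M \<in> upper_group n \<Longrightarrow> j \<le> r \<Longrightarrow> (\<And>c. c \<le> j \<Longrightarrow> w c = 0) \<Longrightarrow>
     h (add_to_row j w M) = (if j = r then sg (\<Sum>c\<in>V. w c) else 1) * h M"
  by (simp add: row_char_def)

definition walk_op :: "nat \<Rightarrow> (bit mat \<Rightarrow> real) \<Rightarrow> bit mat \<Rightarrow> real" where
  "walk_op n f M = (\<Sum>k<n - 1. (f M + f (row_op k M)) / 2) / real (n - 1)"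

text \<open>A translation of row \<open>j\<close> commutes with the row operation up to a
  translation of row \<open>j - 1 < r\<close>, which \<open>h\<close> ignores.\<close>

lemma row_char_row_op:
  assumes h: "row_char n r V h" and k: "k < n - 1"
  shows "row_char n r V (\<lambda>M. h (row_op k M))"
  unfolding row_char_def
proof (intro ballI allI impI)
  fix M j w assume M: "M \<in> upper_group n" and j: "j \<le> r" and w: "\<forall>c\<le>j. w c = (0::bit)"
  note R = row_op_unitri[OF M k]
  have R': "add_to_row j w (row_op k M) \<in> upper_group n" using R w by (intro add_to_row_unitri) auto
  have eq: "h (row_op k (add_to_row j w M)) = h (add_to_row j w (row_op k M))"
  proof (cases "j = Suc k")
    case True
    then show ?thesis using row_charD[OF h R', of k w] j w by (simp add: row_op_add_to_row[OF M k])
  qed (simp add: row_op_add_to_row[OF M k])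
  show "h (row_op k (add_to_row j w M)) = (if j = r then sg (\<Sum>c\<in>V. w c) else 1) * h (row_op k M)"
    unfolding eq using row_charD[OF h R j] w by simp
qed

lemma row_char_walk_op:
  assumes "row_char n r V h"
  shows "row_char n r V (walk_op n h)"
  unfolding row_char_def walk_op_def
proof (intro ballI allI impI)
  fix M j w assume *: "M \<in> upper_group n" "j \<le> r" "\<forall>c\<le>j. w c = (0::bit)"
  let ?s = "if j = r then sg (\<Sum>c\<in>V. w c) else 1"
  have 1: "h (add_to_row j w M) = ?s * h M" using row_charD[OF assms *(1,2)] *(3) by simp
  have 2: "h (row_op k (add_to_row j w M)) = ?s * h (row_op k M)" if "k < n - 1" for k
    using row_charD[OF row_char_row_op[OF assms that] *(1,2)] *(3) by simp
  have "(\<Sum>k<n - 1. (h (add_to_row j w M) + h (row_op k (add_to_row j w M))) / 2)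
      = (\<Sum>k<n - 1. ?s * ((h M + h (row_op k M)) / 2))"
    by (intro sum.cong refl) (simp only: 1 2 lessThan_iff distrib_left times_divide_eq_right)
  then show "(\<Sum>k<n - 1. (h (add_to_row j w M) + h (row_op k (add_to_row j w M))) / 2) / real (n - 1) =
      ?s * ((\<Sum>k<n - 1. (h M + h (row_op k M)) / 2) / real (n - 1))"
    by (simp only: sum_distrib_left times_divide_eq_right)
qed

lemma row_char_walk_op_pow: "row_char n r V h \<Longrightarrow> row_char n r V ((walk_op n ^^ t) h)"
  by (induction t) (simp_all add: row_char_walk_op)

text \<open>
  The configuration is \<open>M v\<close> for the indicator vector \<open>v\<close> of \<open>V\<close>. The bound on \<open>k\<close> is needed because
  entries outside a matrix are unspecified.
\<close>

definition config_of :: "bit mat \<Rightarrow> nat set \<Rightarrow> config" where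
  "config_of M V k \<longleftrightarrow> k < dim_row M \<and> (\<Sum>c\<in>V. M $$ (k, c)) = 1"

lemma config_of_row_op:
  assumes M: "M \<in> upper_group n" and k: "k < n - 1" and V: "V \<subseteq> {..<n}"
  shows "config_of (row_op k M) V =
    (if config_of M V (Suc k) then (config_of M V)(k := \<not> config_of M V k) else config_of M V)"
proof -
  have dim: "dim_row M = n" "dim_col M = n" using M by (auto simp: carrier_unitri)
  let ?x = "\<lambda>i. \<Sum>c\<in>V. M $$ (i, c)"
  have "(\<Sum>c\<in>V. row_op k M $$ (i, c)) = ?x i + (if i = k then ?x (Suc k) else 0)" if "i < n" for i
  proof -
    have "(\<Sum>c\<in>V. row_op k M $$ (i, c)) = (\<Sum>c\<in>V. M $$ (i, c) + (if i = k then M $$ (Suc k, c) else 0))"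
      using V that dim by (intro sum.cong) (auto simp: add.commute)
    then show ?thesis by (simp add: sum.distrib)
  qed
  moreover have "a + b = 1 \<longleftrightarrow> (if b = 1 then a \<noteq> 1 else a = 1)" for a b :: bit
    by (cases a; cases b) auto
  ultimately show ?thesis using k by (auto simp: config_of_def dim fun_eq_iff)
qed

text \<open>
  Averaging the two moves of row \<open>r\<close> multiplies a function of type \<open>V\<close> by 0 or 1 according to
  site \<open>r + 1\<close> of its configuration, which is the killing.
\<close>

lemma walk_op_survival:
  assumes h: "row_char n r V h" and V: "V \<subseteq> {r<..<n}"
    and bound: "\<And>M. M \<in> upper_group n \<Longrightarrow> \<bar>h M\<bar> \<le> 1" and M: "M \<in> upper_group n"
  shows "\<bar>(walk_op n ^^ t) h M\<bar> \<le> survival (n - 1) r t (config_of M V)"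
  using M
proof (induction t arbitrary: M)
  case (Suc t)
  let ?g = "(walk_op n ^^ t) h" and ?u = "survival (n - 1) r t" and ?x = "config_of M V"
  have g: "row_char n r V ?g" by (rule row_char_walk_op_pow[OF h])
  have dim: "dim_row M = n" using Suc.prems by (auto simp: carrier_unitri)
  have "\<bar>(?g M + ?g (row_op k M)) / 2\<bar> \<le> killed_step r k ?u ?x" if k: "k < n - 1" for k
  proof (cases "k \<le> r")
    case True
    have eq: "?g (row_op k M) = (if k = r then sg (\<Sum>c\<in>V. M $$ (Suc k, c)) else 1) * ?g M"
      unfolding row_op_eq_add_to_row
      using k True by (intro row_charD[OF g Suc.prems]) (auto intro!: row_below_zero[OF Suc.prems])
    \<comment> \<open>Either the move flips the sign, so that the two terms cancel, or it is
      invisible.\<close>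
    have "k = r \<and> ?x (Suc k) \<or> (k = r \<longrightarrow> sg (\<Sum>c\<in>V. M $$ (Suc k, c)) = 1) \<and> (k = r \<longrightarrow> \<not> ?x (Suc k))"
      using k by (auto simp: config_of_def dim sg_def)
    then show ?thesis
    proof
      assume *: "k = r \<and> ?x (Suc k)"
      then have "?g (row_op k M) = - ?g M" using eq by (auto simp: config_of_def)
      then show ?thesis using * by (auto simp: killed_step_def)
    next
      assume "(k = r \<longrightarrow> sg (\<Sum>c\<in>V. M $$ (Suc k, c)) = 1) \<and> (k = r \<longrightarrow> \<not> ?x (Suc k))"
      then have "?g (row_op k M) = ?g M" "killed_step r k ?u ?x = ?u ?x"
        using eq True by (auto simp: killed_step_def)
      then show ?thesis using Suc.IH[OF Suc.prems] by simp
    qed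
  next
    case False
    have R: "row_op k M \<in> upper_group n" by (rule row_op_unitri[OF Suc.prems k])
    have "V \<subseteq> {..<n}" using V by auto
    note x' = config_of_row_op[OF Suc.prems k this]
    have "\<bar>(?g M + ?g (row_op k M)) / 2\<bar> \<le> (\<bar>?g M\<bar> + \<bar>?g (row_op k M)\<bar>) / 2" by simp
    also have "\<dots> \<le> (?u ?x + ?u (config_of (row_op k M) V)) / 2"
      using Suc.IH[OF Suc.prems] Suc.IH[OF R] by simp
    also have "\<dots> = killed_step r k ?u ?x"
    proof (cases "?x (Suc k)")
      case True
      \<comment> \<open>Staying and flipping with equal weight is resampling.\<close>
      have "av k ?u ?x = (?u ?x + ?u (?x(k := \<not> ?x k))) / 2"
        by (cases "?x k") (simp_all add: av_def fun_upd_idem)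
      then show ?thesis using True False x' by (simp add: killed_step_def)
    next
      case False
      then show ?thesis using x' by (simp add: killed_step_def)
    qed
    finally show ?thesis .
  qed
  then have "\<bar>\<Sum>k<n - 1. (?g M + ?g (row_op k M)) / 2\<bar> \<le> (\<Sum>k<n - 1. killed_step r k ?u ?x)"
    by (intro order_trans[OF sum_abs] sum_mono) auto
  then show ?case
    unfolding funpow.simps comp_apply walk_op_def[of n ?g M] survival.simps abs_divide abs_of_nat
    by (rule divide_right_mono) simp
qed (simp add: bound)

lemma config_of_Max:
  assumes M: "M \<in> upper_group n" and V: "V \<subseteq> {..<n}" "V \<noteq> {}"
  shows "config_of M V (Max V)" and "Max V < k \<Longrightarrow> \<not> config_of M V k"
proof -
  have fin: "finite V" using V finite_subset by blast
  have j: "Max V \<in> V" using fin V by simp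
  have dim: "dim_row M = n" using M by (auto simp: carrier_unitri)
  have zero: "M $$ (k, c) = 0" if "c < k" "k < n" for k c using row_below_zero[OF M that(2,1)] .
  have "(\<Sum>c\<in>V. M $$ (Max V, c)) = (\<Sum>c\<in>V. if c = Max V then 1 else 0)"
  proof (intro sum.cong refl)
    fix c assume c: "c \<in> V"
    then have "c \<le> Max V" using fin by simp
    then show "M $$ (Max V, c) = (if c = Max V then 1 else 0)"
      using zero[of c "Max V"] j V M by (auto simp: carrier_unitri)
  qed
  then show "config_of M V (Max V)" using fin j V by (auto simp: config_of_def dim)
  show "\<not> config_of M V k" if k: "Max V < k"
  proof
    assume "config_of M V k"
    then have "k < n" "(\<Sum>c\<in>V. M $$ (k, c)) = 1" by (auto simp: config_of_def dim)
    moreover have "(\<Sum>c\<in>V. M $$ (k, c)) = 0"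
    proof (intro sum.neutral ballI)
      fix c assume "c \<in> V"
      then have "c \<le> Max V" using fin by simp
      then show "M $$ (k, c) = 0" using zero k \<open>k < n\<close> by simp
    qed
    ultimately show False by simp
  qed
qed

section \<open>Fourier decomposition along the rows\<close>

definition ind :: "nat set \<Rightarrow> nat \<Rightarrow> bit" where
  "ind W c = of_bool (c \<in> W)"

text \<open>Fourier component of \<open>f\<close> along row \<open>r\<close> at the character of
  \<open>V\<close>.\<close>

definition row_proj :: "nat \<Rightarrow> nat \<Rightarrow> nat set \<Rightarrow> (bit mat \<Rightarrow> real) \<Rightarrow> bit mat \<Rightarrow> real" where
  "row_proj n r V f M =
     (\<Sum>W\<in>Pow {r<..<n}. sg (\<Sum>c\<in>V. ind W c) * f (add_to_row r (ind W) M)) / 2 ^ card {r<..<n}"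

definition row_inv :: "nat \<Rightarrow> nat \<Rightarrow> (bit mat \<Rightarrow> real) \<Rightarrow> bool" where
  "row_inv n r h \<longleftrightarrow> (\<forall>M\<in>upper_group n. \<forall>j<r. \<forall>w. (\<forall>c\<le>j. w c = 0) \<longrightarrow> h (add_to_row j w M) = h M)"

lemma row_invD:
  "row_inv n r h \<Longrightarrow> M \<in> upper_group n \<Longrightarrow> j < r \<Longrightarrow> (\<And>c. c \<le> j \<Longrightarrow> w c = 0) \<Longrightarrow> h (add_to_row j w M) = h M"
  by (simp add: row_inv_def)

lemma row_char_empty: "row_char n r {} h \<Longrightarrow> row_inv n (Suc r) h"
  by (auto simp: row_char_def row_inv_def less_Suc_eq_le)

lemma sum_characters:
  assumes "finite S" "W \<subseteq> S"
  shows "(\<Sum>V\<in>Pow S. sg (\<Sum>c\<in>V. ind W c)) = (if W = {} then 2 ^ card S else 0)"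
proof -
  have "(\<Sum>V\<in>Pow S. sg (\<Sum>c\<in>V. ind W c)) = (\<Sum>V\<in>Pow S. \<Prod>c\<in>V. sg (ind W c))"
    using assms by (intro sum.cong refl sg_sum) (auto intro: finite_subset)
  \<comment> \<open>The expanded product is the sum over \<open>V\<close>; each
    \<open>c \<in> W\<close> makes a factor vanish.\<close>
  also have "\<dots> = (\<Prod>c\<in>S. sg (ind W c) + 1)"
    using assms(1) by (simp add: prod_add)
  also have "\<dots> = (if W = {} then 2 ^ card S else 0)"
  proof (cases "W = {}")
    case False
    then obtain w where "w \<in> W" by auto
    then have "\<exists>c\<in>S. sg (ind W c) + 1 = 0" using assms by (intro bexI[of _ w]) (auto simp: ind_def)
    then show ?thesis using False assms by (simp add: prod_zero)
  qed (simp add: ind_def)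
  finally show ?thesis .
qed

lemma row_proj_decomposition: "(\<Sum>V\<in>Pow {r<..<n}. row_proj n r V f M) = f M"
proof -
  let ?S = "{r<..<n}"
  have "(\<Sum>V\<in>Pow ?S. row_proj n r V f M) =
      (\<Sum>V\<in>Pow ?S. \<Sum>W\<in>Pow ?S. sg (\<Sum>c\<in>V. ind W c) * f (add_to_row r (ind W) M)) / 2 ^ card ?S"
    by (simp only: row_proj_def sum_divide_distrib)
  also have "(\<Sum>V\<in>Pow ?S. \<Sum>W\<in>Pow ?S. sg (\<Sum>c\<in>V. ind W c) * f (add_to_row r (ind W) M)) =
      (\<Sum>W\<in>Pow ?S. \<Sum>V\<in>Pow ?S. sg (\<Sum>c\<in>V. ind W c) * f (add_to_row r (ind W) M))"
    by (rule sum.swap)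
  also have "\<dots> = (\<Sum>W\<in>Pow ?S. if W = {} then 2 ^ card ?S * f (add_to_row r (ind W) M) else 0)"
    by (intro sum.cong refl) (simp only: sum_distrib_right[symmetric] sum_characters[OF finite_greaterThanLessThan] Pow_iff, simp)
  also have "\<dots> = 2 ^ card ?S * f (add_to_row r (ind {}) M)"
    by (subst sum.delta) auto
  also have "add_to_row r (ind {}) M = M"
    using add_to_row_zero[of r M] by (simp add: ind_def[abs_def])
  finally show ?thesis by simp
qed

lemma add_to_row_ind: "W \<subseteq> {r<..<n} \<Longrightarrow> M \<in> upper_group n \<Longrightarrow> add_to_row r (ind W) M \<in> upper_group n"
  by (rule add_to_row_unitri) (auto simp: ind_def)

lemma row_proj_bound:
  assumes "\<And>M. M \<in> upper_group n \<Longrightarrow> \<bar>f M\<bar> \<le> 1" and M: "M \<in> upper_group n"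
  shows "\<bar>row_proj n r V f M\<bar> \<le> 1"
proof -
  let ?S = "{r<..<n}"
  have "\<bar>\<Sum>W\<in>Pow ?S. sg (\<Sum>c\<in>V. ind W c) * f (add_to_row r (ind W) M)\<bar> \<le> (\<Sum>W\<in>Pow ?S. 1)"
    using assms(1)[OF add_to_row_ind[OF _ M]]
    by (intro order_trans[OF sum_abs] sum_mono) (auto simp: abs_mult)
  also have "\<dots> = 2 ^ card ?S" by (simp add: card_Pow)
  finally show ?thesis by (simp add: row_proj_def)
qed

lemma row_char_row_proj:
  assumes f: "row_inv n r f" and V: "V \<subseteq> {r<..<n}"
  shows "row_char n r V (row_proj n r V f)"
  unfolding row_char_def
proof (intro ballI allI impI)
  fix M j w assume M: "M \<in> upper_group n" and j: "j \<le> r" and w: "\<forall>c\<le>j. w c = (0::bit)"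
  let ?S = "{r<..<n}"
  have dim: "dim_row M = n" "dim_col M = n" using M by (auto simp: carrier_unitri)
  show "row_proj n r V f (add_to_row j w M) =
    (if j = r then sg (\<Sum>c\<in>V. w c) else 1) * row_proj n r V f M"
  proof (cases "j = r")
    case False
    then have "j < r" using j by simp
    then have "f (add_to_row r (ind W) (add_to_row j w M)) = f (add_to_row r (ind W) M)" if "W \<subseteq> ?S" for W
      unfolding add_to_row_commute[of r]
      using w add_to_row_ind[OF that M] by (intro row_invD[OF f]) auto
    then show ?thesis using False by (simp add: row_proj_def)
  next
    case True
    define U where "U = {c \<in> ?S. w c = 1}"
    \<comment> \<open>Symmetric difference with the support \<open>U\<close> of \<open>w\<close>,
      that is, addition of \<open>w\<close> to indicator vectors.\<close>
    define T where "T W = (W - U) \<union> (U - W)" for W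
    have US: "U \<subseteq> ?S" by (auto simp: U_def)
    have TT: "T (T W) = W" for W by (auto simp: T_def)
    have TS: "T W \<subseteq> ?S" if "W \<subseteq> ?S" for W using that US by (auto simp: T_def)
    have bit01: "b = 0 \<or> b = 1" for b :: bit by (cases b) auto
    have ind_T: "ind (T W) c = ind W c + w c" if "c \<in> ?S" for W c
      using bit01[of "w c"] that by (auto simp: ind_def T_def U_def)
    have shift: "add_to_row r (ind W) (add_to_row r w M) = add_to_row r (ind (T W)) M" if "W \<subseteq> ?S" for W
    proof -
      have "ind W c + w c = ind (T W) c" if "c < n" for c
      proof (cases "c \<in> ?S")
        case False
        then have "c \<le> r" using that by auto
        then show ?thesis using w True False \<open>W \<subseteq> ?S\<close> TS[of W] by (auto simp: ind_def)
      qed (simp add: ind_T)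
      then show ?thesis unfolding add_to_row_add by (intro eq_matI) (auto simp: add_to_row_def dim)
    qed
    have chr: "sg (\<Sum>c\<in>V. ind (T W) c) = sg (\<Sum>c\<in>V. w c) * sg (\<Sum>c\<in>V. ind W c)" for W
    proof -
      have "(\<Sum>c\<in>V. ind (T W) c) = (\<Sum>c\<in>V. w c + ind W c)"
        by (intro sum.cong refl, subst ind_T) (use V in \<open>auto simp: add.commute\<close>)
      also have "\<dots> = (\<Sum>c\<in>V. w c) + (\<Sum>c\<in>V. ind W c)" by (rule sum.distrib)
      finally have "(\<Sum>c\<in>V. ind (T W) c) = (\<Sum>c\<in>V. w c) + (\<Sum>c\<in>V. ind W c)" .
      then show ?thesis by (simp add: sg_add)
    qed
    have "(\<Sum>W\<in>Pow ?S. sg (\<Sum>c\<in>V. ind W c) * f (add_to_row r (ind W) (add_to_row r w M))) =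
        (\<Sum>W\<in>Pow ?S. sg (\<Sum>c\<in>V. ind (T W) c) * f (add_to_row r (ind W) M))"
      by (rule sum.reindex_bij_witness[of _ T T]) (auto simp: TT TS shift dest: TS[THEN subsetD])
    also have "\<dots> = sg (\<Sum>c\<in>V. w c) * (\<Sum>W\<in>Pow ?S. sg (\<Sum>c\<in>V. ind W c) * f (add_to_row r (ind W) M))"
      by (simp only: chr sum_distrib_left mult.assoc)
    finally show ?thesis using True by (simp add: row_proj_def)
  qed
qed

text \<open>All signs of the empty character are 1, and translations permute the group.\<close>

lemma sum_row_proj:
  "(\<Sum>M\<in>upper_group n. row_proj n r {} f M) = (\<Sum>M\<in>upper_group n. f M)"
proof -
  let ?S = "{r<..<n}" and ?G = "upper_group n"
  have "(\<Sum>M\<in>?G. f (add_to_row r (ind W) M)) = (\<Sum>M\<in>?G. f M)" if W: "W \<subseteq> ?S" for W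
  proof -
    have inv: "add_to_row r (ind W) (add_to_row r (ind W) M) = M" for M
      using add_to_row_zero[of r M] by (simp add: add_to_row_add)
    show ?thesis
      by (rule sum.reindex_bij_witness[of _ "add_to_row r (ind W)" "add_to_row r (ind W)"])
         (use W in \<open>auto simp: inv add_to_row_ind\<close>)
  qed
  then have "(\<Sum>W\<in>Pow ?S. \<Sum>M\<in>?G. f (add_to_row r (ind W) M)) = 2 ^ card ?S * (\<Sum>M\<in>?G. f M)"
    by (simp add: card_Pow)
  then show ?thesis
    by (simp add: row_proj_def sum_divide_distrib[symmetric] sum.swap[of _ "Pow ?S"])
qed

lemma row_inv_const:
  assumes f: "row_inv n n f" and M: "M \<in> upper_group n" and M': "M' \<in> upper_group n"
  shows "f M = f M'"
proof -
  \<comment> \<open>\<open>N j\<close> interpolates from \<open>M\<close> to \<open>M'\<close> row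
    by row; consecutive ones differ by a vector that vanishes up to the diagonal.\<close>
  define N where "N j = mat n n (\<lambda>(i, c). if i < j then M' $$ (i, c) else M $$ (i, c))" for j :: nat
  have NG: "N j \<in> upper_group n" for j using M M' by (auto simp: carrier_unitri N_def)
  have "f (N j) = f M" if "j \<le> n" for j
    using that
  proof (induction j)
    case 0
    have "N 0 = M" using M by (intro eq_matI) (auto simp: N_def carrier_unitri)
    then show ?case by simp
  next
    case (Suc j)
    let ?w = "\<lambda>c. if j < c then M $$ (j, c) + M' $$ (j, c) else 0"
    have "N (Suc j) = add_to_row j ?w (N j)"
    proof (intro eq_matI)
      fix i c assume "i < dim_row (add_to_row j ?w (N j))" "c < dim_col (add_to_row j ?w (N j))"
      then have ic: "i < n" "c < n" by (auto simp: add_to_row_def N_def)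
      have "M $$ (j, c) = M' $$ (j, c)" if "\<not> j < c"
        using that M M' ic Suc.prems by (cases "c = j") (auto simp: carrier_unitri)
      then show "N (Suc j) $$ (i, c) = add_to_row j ?w (N j) $$ (i, c)"
        using ic by (auto simp: N_def add_to_row_def)
    qed (auto simp: N_def add_to_row_def)
    then have "f (N (Suc j)) = f (N j)" using Suc.prems NG by (simp add: row_invD[OF f])
    then show ?case using Suc by simp
  qed
  moreover have "N n = M'" using M' by (intro eq_matI) (auto simp: N_def carrier_unitri)
  ultimately show ?thesis by (metis order_refl)
qed

primrec row_avg :: "nat \<Rightarrow> (bit mat \<Rightarrow> real) \<Rightarrow> nat \<Rightarrow> bit mat \<Rightarrow> real" where
  "row_avg n f 0 = f"
| "row_avg n f (Suc r) = row_proj n r {} (row_avg n f r)"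

lemma row_inv_row_avg: "row_inv n r (row_avg n f r)"
proof (induction r)
  case (Suc r)
  then show ?case by (simp add: row_char_empty row_char_row_proj)
qed (simp add: row_inv_def)

lemma row_avg_bound:
  "(\<And>M. M \<in> upper_group n \<Longrightarrow> \<bar>f M\<bar> \<le> 1) \<Longrightarrow> M \<in> upper_group n \<Longrightarrow> \<bar>row_avg n f r M\<bar> \<le> 1"
  by (induction r arbitrary: M) (auto intro: row_proj_bound)

lemma row_avg_mean:
  assumes M: "M \<in> upper_group n"
  shows "row_avg n f n M = (\<Sum>N\<in>upper_group n. f N) / card (upper_group n)"
proof -
  have "(\<Sum>N\<in>upper_group n. row_avg n f r N) = (\<Sum>N\<in>upper_group n. f N)" for r
    by (induction r) (simp_all add: sum_row_proj)
  from this[of n] have "(\<Sum>N\<in>upper_group n. f N) = (\<Sum>N\<in>upper_group n. row_avg n f n M)"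
    using row_inv_const[OF row_inv_row_avg _ M] by (metis (no_types, lifting) sum.cong)
  moreover have "card (upper_group n) \<noteq> 0" using finite_unitri M by auto
  ultimately show ?thesis by simp
qed

text \<open>Fourier inversion in each row: the trivial character gives the next average, and
  \<open>row_inv_row_avg\<close> makes the other components fit
  \<open>row_char_row_proj\<close>.\<close>

lemma row_avg_decomposition:
  "f M = row_avg n f m M + (\<Sum>r<m. \<Sum>V\<in>Pow {r<..<n} - {{}}. row_proj n r V (row_avg n f r) M)"
proof (induction m)
  case (Suc m)
  have "row_avg n f m M = (\<Sum>V\<in>Pow {m<..<n}. row_proj n m V (row_avg n f m) M)"
    by (simp add: row_proj_decomposition)
  also have "\<dots> = row_avg n f (Suc m) M + (\<Sum>V\<in>Pow {m<..<n} - {{}}. row_proj n m V (row_avg n f m) M)"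
    by (subst sum.remove[of _ "{}"]) auto
  finally show ?case using Suc by simp
qed simp

section \<open>Mixing\<close>

text \<open>Needed because \<open>row_avg_mean\<close> is an identity on the group only.\<close>

lemma walk_op_pow_cong:
  assumes "\<And>M. M \<in> upper_group n \<Longrightarrow> f M = g M" "M \<in> upper_group n"
  shows "(walk_op n ^^ t) f M = (walk_op n ^^ t) g M"
  using assms(2)
proof (induction t arbitrary: M)
  case (Suc t)
  have "(walk_op n ^^ t) f (row_op k M) = (walk_op n ^^ t) g (row_op k M)" if "k < n - 1" for k
    using Suc.IH[OF row_op_unitri[OF Suc.prems that]] .
  then have "(\<Sum>k<n - 1. ((walk_op n ^^ t) f M + (walk_op n ^^ t) f (row_op k M)) / 2) =
      (\<Sum>k<n - 1. ((walk_op n ^^ t) g M + (walk_op n ^^ t) g (row_op k M)) / 2)"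
    using Suc.IH[OF Suc.prems] by (intro sum.cong) auto
  then show ?case
    unfolding funpow.simps comp_apply walk_op_def[of n _ M] by simp
qed (simp add: assms(1))

lemma walk_op_add: "walk_op n (\<lambda>M. f M + g M) = (\<lambda>M. walk_op n f M + walk_op n g M)"
  by (simp add: walk_op_def fun_eq_iff sum.distrib add_divide_distrib sum_divide_distrib algebra_simps)

lemma walk_op_pow_add:
  "(walk_op n ^^ t) (\<lambda>M. f M + g M) = (\<lambda>M. (walk_op n ^^ t) f M + (walk_op n ^^ t) g M)"
  by (induction t) (simp_all add: walk_op_add)

lemma walk_op_pow_zero: "(walk_op n ^^ t) (\<lambda>M. 0) = (\<lambda>M. 0)"
proof (induction t)
  case (Suc t)
  have "walk_op n (\<lambda>M. 0) = (\<lambda>M. 0)" by (simp add: walk_op_def fun_eq_iff)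
  then show ?case using Suc by simp
qed simp

lemma walk_op_pow_sum:
  "finite I \<Longrightarrow> (walk_op n ^^ t) (\<lambda>M. \<Sum>i\<in>I. f i M) M = (\<Sum>i\<in>I. (walk_op n ^^ t) (f i) M)"
  by (induction I rule: finite_induct) (simp_all add: walk_op_pow_zero walk_op_pow_add)

lemma walk_op_pow_const: "n \<ge> 2 \<Longrightarrow> (walk_op n ^^ t) (\<lambda>M. c) M = c"
proof (induction t arbitrary: M)
  case (Suc t)
  then show ?case
    unfolding funpow.simps comp_apply walk_op_def[of n _ M] by simp
qed simp

section \<open>From observables to total variation\<close>

lemma expectation_lazy_step:
  assumes "n \<ge> 2"
  shows "measure_pmf.expectation (lazy_step n M) f = walk_op n f M"
proof -
  let ?I = "{1..n - 1}"
  have ne: "?I \<noteq> {}" using assms by simp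
  have addrow0: "addrow 0 k l M = M" for k l
    by (intro eq_matI) auto
  have inner: "measure_pmf.expectation (pmf_of_set UNIV \<bind> (\<lambda>a. return_pmf (addrow a (i - 1) i M))) f =
      (f M + f (addrow 1 (i - 1) i M)) / 2" for i
  proof -
    have "measure_pmf.expectation (pmf_of_set UNIV \<bind> (\<lambda>a. return_pmf (addrow a (i - 1) i M))) f =
        (\<Sum>a\<in>UNIV. pmf (pmf_of_set UNIV) a *\<^sub>R f (addrow a (i - 1) i M))"
      by (subst pmf_expectation_bind[where A = UNIV]) auto
    then show ?thesis by (simp add: UNIV_bit addrow0 add_divide_distrib)
  qed
  have "measure_pmf.expectation (lazy_step n M) f =
      (\<Sum>i\<in>?I. pmf (pmf_of_set ?I) i *\<^sub>R ((f M + f (addrow 1 (i - 1) i M)) / 2))"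
    unfolding lazy_step_def using ne
    by (subst pmf_expectation_bind[where A = ?I]) (auto simp: inner simp del: One_nat_def)
  also have "\<dots> = (\<Sum>i\<in>?I. (f M + f (addrow 1 (i - 1) i M)) / 2) / real (n - 1)"
    unfolding sum_divide_distrib using ne by (intro sum.cong) auto
  also have "(\<Sum>i\<in>?I. (f M + f (addrow 1 (i - 1) i M)) / 2) = (\<Sum>k<n - 1. (f M + f (row_op k M)) / 2)"
    by (rule sum.reindex_bij_witness[of _ Suc "\<lambda>i. i - 1"]) auto
  finally show ?thesis by (simp only: walk_op_def)
qed

lemma chain_law_closed:
  "n \<ge> 2 \<Longrightarrow> y \<in> upper_group n \<Longrightarrow> set_pmf (chain_law (lazy_step n) y t) \<subseteq> upper_group n"
  by (induction t) (use lazy_step_closed in \<open>auto simp: subset_iff\<close>)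

lemma expectation_chain_law:
  assumes "n \<ge> 2" "y \<in> upper_group n"
  shows "measure_pmf.expectation (chain_law (lazy_step n) y t) f = (walk_op n ^^ t) f y"
proof (induction t arbitrary: f)
  case (Suc t)
  let ?p = "chain_law (lazy_step n) y t"
  have "measure_pmf.expectation (?p \<bind> lazy_step n) f =
      (\<Sum>M\<in>upper_group n. pmf ?p M *\<^sub>R walk_op n f M)"
    using finite_subset[OF lazy_step_closed[OF assms(1)] finite_unitri]
    by (subst pmf_expectation_bind[OF finite_unitri _ chain_law_closed[OF assms]])
       (simp_all add: expectation_lazy_step assms(1))
  also have "\<dots> = measure_pmf.expectation ?p (walk_op n f)"
    using chain_law_closed[OF assms] by (subst integral_measure_pmf[OF finite_unitri]) auto
  finally show ?case by (simp add: Suc funpow_swap1)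
qed simp

lemma walk_op_deviation:
  assumes gap: "east_gap \<gamma> (n - 1)" and \<gamma>: "0 < \<gamma>" "\<gamma> \<le> 1" and n: "n \<ge> 2"
    and f: "\<And>M. M \<in> upper_group n \<Longrightarrow> \<bar>f M\<bar> \<le> 1" and M: "M \<in> upper_group n"
  shows "\<bar>(walk_op n ^^ t) f M - (\<Sum>N\<in>upper_group n. f N) / card (upper_group n)\<bar> \<le>
    real n * 2 ^ n * sqrt (2 ^ (n - 1) * exp (- \<gamma> * real t / real (n - 1)))"
proof -
  let ?G = "upper_group n" and ?P = "\<lambda>r. Pow {r<..<n} - {{}}"
  let ?mean = "(\<Sum>N\<in>?G. f N) / card ?G"
  let ?h = "\<lambda>r V. row_proj n r V (row_avg n f r)"
  let ?e = "sqrt (2 ^ (n - 1) * exp (- \<gamma> * real t / real (n - 1)))"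
  have "(walk_op n ^^ t) f M = (walk_op n ^^ t) (\<lambda>M. ?mean + (\<Sum>r<n. \<Sum>V\<in>?P r. ?h r V M)) M"
    using row_avg_decomposition[of f _ n n] row_avg_mean M by (intro walk_op_pow_cong) auto
  also have "\<dots> = ?mean + (\<Sum>r<n. \<Sum>V\<in>?P r. (walk_op n ^^ t) (?h r V) M)"
    by (simp add: walk_op_pow_add walk_op_pow_sum walk_op_pow_const n)
  finally have "\<bar>(walk_op n ^^ t) f M - ?mean\<bar> = \<bar>\<Sum>r<n. \<Sum>V\<in>?P r. (walk_op n ^^ t) (?h r V) M\<bar>"
    by simp
  also have "\<dots> \<le> (\<Sum>r<n. \<Sum>V\<in>?P r. \<bar>(walk_op n ^^ t) (?h r V) M\<bar>)"
    by (intro order_trans[OF sum_abs] sum_mono sum_abs)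
  also have "\<dots> \<le> (\<Sum>r<n. \<Sum>V\<in>?P r. ?e)"
  proof (intro sum_mono)
    fix r V assume r: "r \<in> {..<n}" and "V \<in> ?P r"
    then have V: "V \<subseteq> {r<..<n}" "V \<subseteq> {..<n}" "V \<noteq> {}" by auto
    have "Max V \<in> {r<..<n}" using V finite_subset by (intro subsetD[OF V(1)] Max_in) auto
    then have j: "r < Max V" "Max V \<le> n - 1" by auto
    have "\<bar>(walk_op n ^^ t) (?h r V) M\<bar> \<le> survival (n - 1) r t (config_of M V)"
      by (rule walk_op_survival[OF row_char_row_proj[OF row_inv_row_avg V(1)] V(1) _ M])
         (intro row_proj_bound row_avg_bound f)
    also have "\<dots> \<le> ?e"
      by (intro real_le_rsqrt survival_bound[OF gap \<gamma> j] config_of_Max[OF M V(2,3)])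
    finally show "\<bar>(walk_op n ^^ t) (?h r V) M\<bar> \<le> ?e" .
  qed
  also have "\<dots> \<le> (\<Sum>r<n. 2 ^ n * ?e)"
  proof (intro sum_mono)
    fix r
    have "card (?P r) \<le> card (Pow {..<n})" by (intro card_mono) auto
    also have "\<dots> = 2 ^ n" by (simp add: card_Pow)
    finally have "real (card (?P r)) \<le> 2 ^ n" by (metis of_nat_le_iff of_nat_numeral of_nat_power)
    then show "(\<Sum>V\<in>?P r. ?e) \<le> 2 ^ n * ?e" by (simp only: sum_constant) (intro mult_right_mono, auto)
  qed
  finally show ?thesis by (simp only: sum_constant card_lessThan mult.assoc)
qed

lemma tv_dist_bound:
  assumes "east_gap \<gamma> (n - 1)" "0 < \<gamma>" "\<gamma> \<le> 1" and n: "n \<ge> 2" and y: "y \<in> upper_group n"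
  shows "tv_dist (upper_group n) (chain_law (lazy_step n) y t) (pmf_of_set (upper_group n)) \<le>
    real n * 2 ^ n * sqrt (2 ^ (n - 1) * exp (- \<gamma> * real t / real (n - 1)))"
  unfolding tv_dist_def
proof (rule cSUP_least)
  fix A assume "A \<in> Pow (upper_group n)"
  let ?f = "indicator A :: bit mat \<Rightarrow> real"
  have "measure_pmf.prob (chain_law (lazy_step n) y t) A = (walk_op n ^^ t) ?f y"
    using expectation_chain_law[OF n y, of t ?f] by simp
  moreover have "measure_pmf.prob (pmf_of_set (upper_group n)) A =
      (\<Sum>N\<in>upper_group n. ?f N) / card (upper_group n)"
    using integral_pmf_of_set[of "upper_group n" ?f] y finite_unitri[of n] by auto
  ultimately show "\<bar>measure_pmf.prob (chain_law (lazy_step n) y t) A -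
      measure_pmf.prob (pmf_of_set (upper_group n)) A\<bar> \<le>
      real n * 2 ^ n * sqrt (2 ^ (n - 1) * exp (- \<gamma> * real t / real (n - 1)))"
    using walk_op_deviation[OF assms(1-3) n _ y, of ?f t] by (simp add: indicator_def)
qed auto

text \<open>By \<open>2 \<le> exp 1\<close> and \<open>n \<le> exp n\<close> the exponent is at most
  \<open>n + n + (n - 10 * n) / 2 = - 5 / 2 * n\<close>, so at most -5, and \<open>exp 4 > 2\<close>
  suffices. This accounts for the constant 10.\<close>

lemma deviation_small:
  assumes \<gamma>: "0 < \<gamma>" and n: "n \<ge> 2" and t: "10 * (real n)\<^sup>2 / \<gamma> \<le> real t"
  shows "real n * 2 ^ n * sqrt (2 ^ (n - 1) * exp (- \<gamma> * real t / real (n - 1))) < 1 / (2 * exp 1)"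
proof -
  have two_exp: "(2::real) ^ k \<le> exp (real k)" for k
    using power_mono[of 2 "exp 1 :: real" k] exp_ge_add_one_self[of "1::real"]
    by (simp flip: exp_of_nat_mult)
  have "10 * real n * real (n - 1) \<le> 10 * (real n)\<^sup>2"
    using n by (simp add: power2_eq_square)
  also have "\<dots> \<le> \<gamma> * real t" using t \<gamma> by (simp add: field_simps)
  finally have "10 * real n \<le> \<gamma> * real t / real (n - 1)" using n by (simp add: field_simps)
  then have "exp (- \<gamma> * real t / real (n - 1)) \<le> exp (- (10 * real n))" by simp
  moreover have "(2::real) ^ (n - 1) \<le> exp (real n)"
    using two_exp[of n] power_increasing[of "n - 1" n "2::real"] by linarith
  ultimately have "2 ^ (n - 1) * exp (- \<gamma> * real t / real (n - 1)) \<le> exp (real n) * exp (- (10 * real n))"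
    by (intro mult_mono) auto
  also have "\<dots> = (exp (- (9 / 2 * real n)))\<^sup>2" by (simp flip: exp_add exp_double)
  finally have root: "sqrt (2 ^ (n - 1) * exp (- \<gamma> * real t / real (n - 1))) \<le> exp (- (9 / 2 * real n))"
    by (intro real_le_lsqrt) auto
  have "real n \<le> exp (real n)" using exp_ge_add_one_self[of "real n"] by linarith
  then have "real n * 2 ^ n \<le> exp (real n) * exp (real n)" using two_exp[of n] by (intro mult_mono) auto
  then have "real n * 2 ^ n * sqrt (2 ^ (n - 1) * exp (- \<gamma> * real t / real (n - 1))) \<le>
      exp (real n) * exp (real n) * exp (- (9 / 2 * real n))"
    using root by (rule mult_mono) auto
  also have "\<dots> = exp (- (5 / 2 * real n))" by (simp flip: exp_add)
  also have "\<dots> \<le> exp (- 4 - 1)" using n by simp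
  also have "\<dots> = 1 / (exp 4 * exp 1)" by (simp only: exp_diff exp_minus) (simp add: field_simps)
  also have "\<dots> < 1 / (2 * exp 1)"
    using exp_ge_add_one_self[of "4::real"] by (intro divide_strict_left_mono) auto
  finally show ?thesis .
qed

theorem theorem1:
  shows "\<exists>C::real. C > 0 \<and>
           (\<forall>n::nat. n \<ge> 2 \<longrightarrow> ereal_of_enat (t_mix n) \<le> ereal (C * (real n)\<^sup>2))"
proof -
  obtain c where c: "0 < c" and gap_c: "\<And>L. east_gap c L" using east_gap_uniform by blast
  define \<gamma> where "\<gamma> = min c 1"
  have \<gamma>: "0 < \<gamma>" "\<gamma> \<le> 1" using c by (auto simp: \<gamma>_def)
  have gap: "east_gap \<gamma> L" for L by (rule east_gap_mono[OF gap_c]) (auto simp: \<gamma>_def)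
  have "ereal_of_enat (t_mix n) \<le> ereal ((10 / \<gamma> + 1) * (real n)\<^sup>2)" if n: "n \<ge> 2" for n
  proof -
    define t where "t = nat \<lceil>10 * (real n)\<^sup>2 / \<gamma>\<rceil>"
    have pos: "0 \<le> 10 * (real n)\<^sup>2 / \<gamma>" using \<gamma> by simp
    have t: "10 * (real n)\<^sup>2 / \<gamma> \<le> real t" "real t \<le> 10 * (real n)\<^sup>2 / \<gamma> + 1"
      using pos unfolding t_def by linarith+
    have "(SUP y\<in>upper_group n. tv_dist (upper_group n) (chain_law (lazy_step n) y t) (pmf_of_set (upper_group n)))
        \<le> real n * 2 ^ n * sqrt (2 ^ (n - 1) * exp (- \<gamma> * real t / real (n - 1)))"
      using one_unitri by (intro cSUP_least tv_dist_bound[OF gap \<gamma> n]) auto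
    also have "\<dots> < 1 / (2 * exp 1)" by (rule deviation_small[OF \<gamma>(1) n t(1)])
    finally have "t_mix n \<le> enat t" unfolding t_mix_def mixing_time_def by (intro INF_lower) simp
    then have "ereal_of_enat (t_mix n) \<le> ereal_of_enat (enat t)" by (simp only: ereal_of_enat_le_iff)
    also have "\<dots> = ereal (real t)" by simp
    also have "\<dots> \<le> ereal ((10 / \<gamma> + 1) * (real n)\<^sup>2)"
    proof -
      \<comment> \<open>The \<open>+ 1\<close> in the constant absorbs the rounding of
        \<open>t\<close>.\<close>
      have "1 \<le> (real n)\<^sup>2" using n by (simp add: one_le_power)
      then show ?thesis using t(2) by (simp add: distrib_right)
    qed
    finally show ?thesis .
  qed
  moreover have "0 < 10 / \<gamma> + 1" using \<gamma> by (simp add: add_pos_pos)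
  ultimately show ?thesis by blast
qed

end
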